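(* Let $A,B\in\mathbb{C}_{n,n}$. Then $A\overset{\mathtt{CM}}{\le}B$ if and only if there exists a unitary matrix $U$ such that $$A=U\begin{bmatrix}T_1&T_2&S_1\\0&0&0\\0&0&N_1\end{bmatrix}U^\ast,\qquad B=U\begin{bmatrix}T_1&T_2&S_1\\0&T_3&S_2\\0&0&N_2\end{bmatrix}U^\ast$$ (conformal partitions with square diagonal blocks), where $T_1$ and $T_3$ are non-singular, and $N_1$ and $N_2$ are nilpotent and satisfy $N_1\overset{-}{\le}N_2$.
   Context: $\mathbb{C}_{n,n}$ is the set of $n\times n$ complex matrices, $A^\ast$ is the conjugate transpose, $\mathrm{rk}$ the rank, $\mathcal{R}(A)$ the column space, $A^\dag$ the Moore-Penrose inverse. The index $\mathrm{Ind}(A)$ is $0$ if $A$ is non-singular, and otherwise is the smallest positive integer $k$ with $\mathrm{rk}(A^{k+1})=\mathrm{rk}(A^k)$. $\mathbb{C}_n^{\mathtt{CM}}=\{A\in\mathbb{C}_{n,n} : \mathrm{rk}(A^2)=\mathrm{rk}(A)\}$ (core-invertible matrices). Blocks in partitioned matrices may be empty. Core-EP decomposition: for $A\in\mathbb{C}_{n,n}$ with $\mathrm{Ind}(A)=k$, it is the (existing and unique) decomposition $A=A_1+A_2$ with $A_1\in\mathbb{C}_n^{\mathtt{CM}}$, $A_2^k=0$ (read as $A_2=0$ when $k=0$), and $A_1^\ast A_2=A_2A_1=0$. Core inverse: for $A\in\mathbb{C}_n^{\mathtt{CM}}$, $A^{(\#)}$ is the unique $X\in\mathbb{C}_{n,n}$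 with $AX=AA^\dag$ and $\mathcal{R}(X)\subseteq\mathcal{R}(A)$. Core partial order: for $A,B\in\mathbb{C}_n^{\mathtt{CM}}$, $A\overset{(\#)}{\le}B$ means $A^{(\#)}A=A^{(\#)}B$ and $AA^{(\#)}=BA^{(\#)}$. Minus partial order: for matrices of the same size, $A\overset{-}{\le}B$ means $\mathrm{rk}(B)-\mathrm{rk}(A)=\mathrm{rk}(B-A)$. Core-minus order: for $A,B\in\mathbb{C}_{n,n}$ with core-EP decompositions $A=A_1+A_2$ and $B=B_1+B_2$ ($A_1,B_1$ core-invertible, $A_2,B_2$ nilpotent), $A\overset{\mathtt{CM}}{\le}B$ means $A_1\overset{(\#)}{\le}B_1$ and $A_2\overset{-}{\le}B_2$. *)

theory Defs
  imports
    "Jordan_Normal_Form.DL_Rank"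
    "Jordan_Normal_Form.Schur_Decomposition"
begin

text \<open>
  Matrices are those of \<^typ>\<open>complex mat\<close> with explicit dimensions, so that blocks of a
  partitioned matrix may have zero rows or columns.
\<close>

abbreviation rk :: "complex mat \<Rightarrow> nat" where
  "rk A \<equiv> vec_space.rank (dim_row A) A"

abbreviation range_mat :: "complex mat \<Rightarrow> complex vec set" where
  "range_mat A \<equiv> vec_space.col_space (dim_row A) A"

definition unitary_mat :: "complex mat \<Rightarrow> bool" where
  "unitary_mat U \<longleftrightarrow> square_mat U \<and> inverts_mat U (mat_adjoint U) \<and> inverts_mat (mat_adjoint U) U"

definition nilpotent_mat :: "complex mat \<Rightarrow> bool" where
  "nilpotent_mat N \<longleftrightarrow> square_mat N \<and> (\<exists>k. N ^\<^sub>m k = 0\<^sub>m (dim_row N) (dim_row N))"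

definition matrix_index :: "complex mat \<Rightarrow> nat" where
  "matrix_index A = (if invertible_mat A then 0
     else (LEAST k. 0 < k \<and> rk (A ^\<^sub>m (k + 1)) = rk (A ^\<^sub>m k)))"

text \<open>The Moore-Penrose inverse, characterised by the four Penrose equations.\<close>

definition is_moore_penrose :: "complex mat \<Rightarrow> complex mat \<Rightarrow> bool" where
  "is_moore_penrose A X \<longleftrightarrow>
     X \<in> carrier_mat (dim_col A) (dim_row A) \<and>
     A * X * A = A \<and> X * A * X = X \<and>
     mat_adjoint (A * X) = A * X \<and> mat_adjoint (X * A) = X * A"

definition moore_penrose :: "complex mat \<Rightarrow> complex mat" where
  "moore_penrose A = (THE X. is_moore_penrose A X)"

definition core_invertible :: "nat \<Rightarrow> complex mat set" where
  "core_invertible n = {A \<in> carrier_mat n n. rk (A * A) = rk A}"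

text \<open>Meaningful only for core-invertible \<open>A\<close>, for which \<open>X\<close> exists and is unique.\<close>

definition core_inverse :: "complex mat \<Rightarrow> complex mat" where
  "core_inverse A = (THE X. X \<in> carrier_mat (dim_row A) (dim_row A) \<and>
     A * X = A * moore_penrose A \<and> range_mat X \<subseteq> range_mat A)"

definition core_le :: "nat \<Rightarrow> complex mat \<Rightarrow> complex mat \<Rightarrow> bool" where
  "core_le n A B \<longleftrightarrow> A \<in> core_invertible n \<and> B \<in> core_invertible n \<and>
     core_inverse A * A = core_inverse A * B \<and> A * core_inverse A = B * core_inverse A"

text \<open>Rank subtractivity, over the integers to avoid truncated subtraction.\<close>

definition minus_le :: "complex mat \<Rightarrow> complex mat \<Rightarrow> bool" where
  "minus_le A B \<longleftrightarrow> dim_row A = dim_row B \<and> dim_col A = dim_col B \<and>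
     int (rk B) - int (rk A) = int (rk (B - A))"

text \<open>
  The case of index \<open>0\<close> is separate: there \<open>A2\<close> has to vanish, whereas \<open>A2 ^\<^sub>m 0\<close>
  is the identity matrix.
\<close>

definition core_EP_decomposition ::
  "nat \<Rightarrow> complex mat \<Rightarrow> complex mat \<Rightarrow> complex mat \<Rightarrow> bool" where
  "core_EP_decomposition n A A1 A2 \<longleftrightarrow>
     A1 \<in> core_invertible n \<and> A2 \<in> carrier_mat n n \<and> A = A1 + A2 \<and>
     (if matrix_index A = 0 then A2 = 0\<^sub>m n n else A2 ^\<^sub>m matrix_index A = 0\<^sub>m n n) \<and>
     mat_adjoint A1 * A2 = 0\<^sub>m n n \<and> A2 * A1 = 0\<^sub>m n n"

text \<open>
  Every square matrix has exactly one core-EP decomposition, so the quantifiers below merely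
  name the two parts of \<open>A\<close> and of \<open>B\<close>.
\<close>

definition core_minus_le :: "nat \<Rightarrow> complex mat \<Rightarrow> complex mat \<Rightarrow> bool" where
  "core_minus_le n A B \<longleftrightarrow> (\<exists>A1 A2 B1 B2.
     core_EP_decomposition n A A1 A2 \<and> core_EP_decomposition n B B1 B2 \<and>
     core_le n A1 B1 \<and> minus_le A2 B2)"

definition append_cols :: "'a :: zero mat \<Rightarrow> 'a mat \<Rightarrow> 'a mat" where
  "append_cols A B = four_block_mat A B (0\<^sub>m 0 (dim_col A)) (0\<^sub>m 0 (dim_col B))"

text \<open>The arguments are the nine blocks of a \<open>3 \<times> 3\<close> partition, row by row.\<close>

definition nine_block_mat ::
  "'a :: zero mat \<Rightarrow> 'a mat \<Rightarrow> 'a mat \<Rightarrow> 'a mat \<Rightarrow> 'a mat \<Rightarrow> 'a mat \<Rightarrow> 'a mat \<Rightarrow> 'a mat \<Rightarrow> 'a mat \<Rightarrow> 'a mat"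
where
  "nine_block_mat A B C D E F G H I =
     four_block_mat A (append_cols B C) (D @\<^sub>r G) (four_block_mat E F H I)"

end

theory Submission
  imports Defs
begin

text \<open>
  Every square matrix is unitarily similar to \<open>[T, S; 0, N]\<close> with \<open>T\<close> non-singular and \<open>N\<close>
  nilpotent, by induction on the size: if \<open>A\<close> is singular, a unit vector orthogonal to its range,
  put last in an orthonormal basis, clears the last row. For core-invertible matrices \<open>N = 0\<close>, and then the
  core inverse is \<open>[T\<^sup>-\<^sup>1, 0; 0, 0]\<close>, so that \<open>A1\<close> is below \<open>B1\<close> in the core order exactly when
  \<open>B1 = [T, S; 0, G]\<close>; this \<open>G\<close> is again core-invertible, and applying its block form gives the first
  two block columns of \<open>B\<close>. The orthogonality relations force \<open>B2\<close> into the last diagonal block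
  and \<open>A2\<close> into the last two; since the minus order implies inclusion of column and of row spaces, \<open>A2\<close> is
  confined to the last block as well.
\<close>

section \<open>Rank and column space\<close>

text \<open>Ranks occur in all the orders but cannot be read off block by block, so each rank
  condition is traded for an equation: \<open>rk (A * B) = rk A\<close> gives
  \<open>A = A * B * Y\<close>. This yields \<open>A = A * A * X\<close> for core-invertible
  matrices, factorisations \<open>A = B * Y\<close> and \<open>A = W * B\<close> below
  \<open>B\<close> in the minus order, and a factorisation of the power of \<open>A\<close> at its
  index. In the induction a last row is cleared, rather than a first column, so that each zero
  eigenvalue lands directly in the nilpotent corner and no eigenvalues have to be reordered. The
  core inverse is a definite description that refers to another one, the Moore-Penrose inverse; both
  are evaluated explicitly, which rests on \<open>[T, S]\<close> having full row rank. One basis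
  must serve both matrices. It arises in two rounds: \<open>U0\<close> for \<open>A1\<close>, and a
  refinement \<open>V\<close> for the lower block of \<open>B1\<close>. As \<open>V\<close> mixes
  all columns to the right of \<open>T1\<close>, that block stays whole and is cut into
  \<open>T2\<close> and \<open>S1\<close> only at the end.\<close>

context vec_space begin

text \<open>\<open>rank\<close> is the dimension of the span of the columns, and independence is the
  same in a subspace as in the whole space, so the usual dimension bound applies inside that
  span.\<close>

lemma card_le_rank:
  assumes A: "A \<in> carrier_mat n nc" and S: "S \<subseteq> col_space A" and li: "lin_indpt S"
  shows "card S \<le> rank A"
proof -
  have cA: "set (cols A) \<subseteq> carrier_vec n" using A cols_dim by blast
  have vs: "vectorspace class_ring (span_vs (set (cols A)))"
    using cA span_is_subspace subspace_is_vs by auto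
  have "LinearCombinations.module.lin_indpt class_ring (span_vs (set (cols A))) S"
    using span_li_not_depend(2)[OF S[unfolded col_space_def] span_is_submodule] cA li by auto
  then show ?thesis
    unfolding rank_def using vectorspace.li_le_dim(2)[OF vs fin_dim_span_cols[OF A]] S
    by (simp add: col_space_def)
qed

lemma ex_rank_basis:
  assumes A: "A \<in> carrier_mat n nc"
  obtains S where "finite S" "S \<subseteq> set (cols A)" "lin_indpt S" "card S = rank A"
proof -
  have "lin_indpt {}" using finite_lin_indpt2 by fastforce
  then obtain S where "finite S" "maximal S (\<lambda>T. T \<subseteq> set (cols A) \<and> lin_indpt T)"
    using maximal_exists_superset[of "set (cols A)" "\<lambda>T. T \<subseteq> set (cols A) \<and> lin_indpt T" "{}"]
    by auto
  then show thesis using that rank_card_indpt[OF A] unfolding maximal_def by metis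
qed

lemma rank_mono:
  assumes M: "M \<in> carrier_mat n nc" and A: "A \<in> carrier_mat n nc'"
    and sub: "col_space M \<subseteq> col_space A"
  shows "rank M \<le> rank A"
proof -
  obtain S where S: "S \<subseteq> set (cols M)" "lin_indpt S" "card S = rank M"
    using ex_rank_basis[OF M] by metis
  have "set (cols M) \<subseteq> carrier_vec n" using M cols_dim by blast
  then have "set (cols M) \<subseteq> col_space M" unfolding col_space_def by (rule in_own_span)
  with S(1) sub have "S \<subseteq> col_space A" by blast
  from card_le_rank[OF A this S(2)] S(3) show ?thesis by simp
qed

text \<open>A column of \<open>A\<close> outside the span of a column basis of \<open>M\<close>
  would enlarge this basis to more than \<open>rank A\<close> independent vectors in the column
  space of \<open>A\<close>.\<close>

lemma col_space_eqI_rank: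
  assumes M: "M \<in> carrier_mat n nc" and A: "A \<in> carrier_mat n nc'"
    and sub: "col_space M \<subseteq> col_space A" and rk: "rank M = rank A"
  shows "col_space M = col_space A"
proof -
  obtain S where fin: "finite S" and S: "S \<subseteq> set (cols M)" "lin_indpt S" "card S = rank M"
    using ex_rank_basis[OF M] by metis
  have cM: "set (cols M) \<subseteq> carrier_vec n" and cA: "set (cols A) \<subseteq> carrier_vec n"
    using M A cols_dim by blast+
  have own: "set (cols M) \<subseteq> col_space M"
    using in_own_span[of "set (cols M)"] cM unfolding col_space_def by auto
  have "set (cols A) \<subseteq> span S"
  proof
    fix v assume v: "v \<in> set (cols A)"
    show "v \<in> span S"
    proof (rule ccontr)
      assume nv: "v \<notin> span S"
      have Sc: "S \<subseteq> carrier_vec n" using S(1) cM by auto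
      have vc: "v \<in> carrier_vec n" using v cA by auto
      have vS: "v \<notin> S" using nv in_own_span[of S] Sc by auto
      have "lin_indpt (S \<union> {v})" 
        using lin_dep_iff_in_span[OF Sc S(2) vc vS] nv by auto
      moreover have "S \<union> {v} \<subseteq> col_space A"
        using S(1) own sub v in_own_span[of "set (cols A)"] cA unfolding col_space_def by auto
      ultimately have "card (S \<union> {v}) \<le> rank A" by (metis card_le_rank[OF A])
      moreover have "card (S \<union> {v}) = Suc (card S)" using fin vS by simp
      ultimately show False using S(3) rk by simp
    qed
  qed
  also have "span S \<subseteq> col_space M" unfolding col_space_def by (rule span_is_monotone[OF S(1)])
  finally have "col_space A \<subseteq> col_space M"
    using span_is_subset[of "set (cols A)" "col_space M"] span_is_submodule[of "set (cols M)"] cM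
    unfolding col_space_def by auto
  with sub show ?thesis by auto
qed

lemma col_space_mult_subset:
  assumes A: "A \<in> carrier_mat n m" and B: "B \<in> carrier_mat m k"
  shows "col_space (A * B) \<subseteq> col_space A"
proof -
  have AB: "A * B \<in> carrier_mat n k" using A B by auto
  show ?thesis unfolding col_space_eq[OF A] col_space_eq[OF AB]
    using A B by (auto intro!: bexI[of _ "B *\<^sub>v _"])
qed

text \<open>Solving \<open>A *\<^sub>v y = col M j\<close> for each \<open>j\<close> and collecting
  the solutions as columns gives \<open>Y\<close>.\<close>

lemma col_space_subset_imp_factor:
  assumes M: "M \<in> carrier_mat n k" and A: "A \<in> carrier_mat n m"
    and sub: "col_space M \<subseteq> col_space A"
  shows "\<exists>Y \<in> carrier_mat m k. M = A * Y"
proof -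
  have "\<exists>y \<in> carrier_vec m. A *\<^sub>v y = col M j" if "j < k" for j
  proof -
    have "M *\<^sub>v unit_vec k j = col M j" using M that by auto
    moreover have "unit_vec k j \<in> carrier_vec k" by simp
    ultimately have "col M j \<in> col_space M" unfolding col_space_eq[OF M] using M by auto
    then have "col M j \<in> col_space A" using sub by auto
    then show ?thesis unfolding col_space_eq[OF A] using A by auto
  qed
  then obtain y where y: "\<And>j. j < k \<Longrightarrow> y j \<in> carrier_vec m \<and> A *\<^sub>v y j = col M j" by metis
  define Y where "Y = mat m k (\<lambda>(i,j). y j $ i)"
  have Y: "Y \<in> carrier_mat m k" unfolding Y_def by auto
  have "M = A * Y"
  proof (rule eq_matI)
    fix i j assume "i < dim_row (A * Y)" "j < dim_col (A * Y)"
    then have i: "i < n" and j: "j < k" using A Y by auto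
    have "col Y j = y j" unfolding Y_def using y[OF j] j by (intro eq_vecI) auto
    then have "(A * Y) $$ (i,j) = (A *\<^sub>v y j) $ i" using A Y i j by auto
    also have "\<dots> = M $$ (i,j)" using y[OF j] M i j by auto
    finally show "M $$ (i,j) = (A * Y) $$ (i,j)" by simp
  qed (use A M Y in auto)
  with Y show ?thesis by auto
qed

text \<open>Full-rank factorisation: a maximal independent set of columns of \<open>A\<close> spans
  its column space, so \<open>A\<close> factors through the matrix \<open>P\<close> formed by
  them.\<close>

lemma rank_factorization:
  assumes A: "A \<in> carrier_mat n m"
  shows "\<exists>P \<in> carrier_mat n (rank A). \<exists>Q \<in> carrier_mat (rank A) m. A = P * Q"
proof -
  obtain S where fin: "finite S" and S: "S \<subseteq> set (cols A)" "lin_indpt S" "card S = rank A"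
    using ex_rank_basis[OF A] by metis
  obtain xs where xs: "set xs = S" "distinct xs" using fin finite_distinct_list by metis
  have len: "length xs = rank A" using xs S(3) distinct_card by metis
  have cA: "set (cols A) \<subseteq> carrier_vec n" using A cols_dim by blast
  define P where "P = mat_of_cols n xs"
  have P: "P \<in> carrier_mat n (rank A)" unfolding P_def len[symmetric] by auto
  have cols: "cols P = xs" unfolding P_def using xs S(1) cA by (simp add: cols_mat_of_cols)
  have "rank P = rank A" using lin_indpt_full_rank[OF P] cols xs S by simp
  moreover have "col_space P \<subseteq> col_space A" unfolding col_space_def cols xs
    by (rule span_is_monotone[OF S(1)])
  ultimately have "col_space P = col_space A" using col_space_eqI_rank[OF P A] by simp
  then show ?thesis using col_space_subset_imp_factor[OF A P] P by auto
qed

lemma rank_mult_le_inner: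
  assumes A: "A \<in> carrier_mat n m" and B: "B \<in> carrier_mat m k"
  shows "rank (A * B) \<le> m"
  using rank_mono[OF _ A col_space_mult_subset[OF A B]] rank_le_nc[OF A] A B
  by (meson mult_carrier_mat order_trans)

end

section \<open>Block matrices and adjoints\<close>

lemma mat_add_zero [simp]:
  fixes A :: "'a :: monoid_add mat"
  shows "dim_row A = m \<Longrightarrow> dim_col A = k \<Longrightarrow> 0\<^sub>m m k + A = A"
    and "dim_row A = m \<Longrightarrow> dim_col A = k \<Longrightarrow> A + 0\<^sub>m m k = A"
  by (auto intro!: eq_matI)

lemma mat_mult_assoc:
  fixes A :: "'a :: semiring_0 mat"
  assumes "dim_col A = dim_row B" "dim_col B = dim_row C"
  shows "A * B * C = A * (B * C)"
  using assms by (intro assoc_mult_mat[of _ "dim_row A" "dim_col A" _ "dim_col B" _ "dim_col C"]) auto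

text \<open>
  The side conditions are on dimensions instead of carriers, so that the simplifier can discharge them
  without guessing block sizes.
\<close>

lemma four_block_mult:
  fixes A1 :: "'a :: semiring_0 mat"
  assumes "dim_row B1 = dim_row A1" "dim_col C1 = dim_col A1" "dim_row D1 = dim_row C1" "dim_col D1 = dim_col B1"
    and "dim_row B2 = dim_row A2" "dim_col C2 = dim_col A2" "dim_row D2 = dim_row C2" "dim_col D2 = dim_col B2"
    and "dim_col A1 = dim_row A2" "dim_col D1 = dim_row C2"
  shows "four_block_mat A1 B1 C1 D1 * four_block_mat A2 B2 C2 D2
    = four_block_mat (A1 * A2 + B1 * C2) (A1 * B2 + B1 * D2) (C1 * A2 + D1 * C2) (C1 * B2 + D1 * D2)"
proof -
  have "A1 \<in> carrier_mat (dim_row A1) (dim_col A1)" "B1 \<in> carrier_mat (dim_row A1) (dim_col D1)"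
    "C1 \<in> carrier_mat (dim_row D1) (dim_col A1)" "D1 \<in> carrier_mat (dim_row D1) (dim_col D1)"
    "A2 \<in> carrier_mat (dim_col A1) (dim_col A2)" "B2 \<in> carrier_mat (dim_col A1) (dim_col D2)"
    "C2 \<in> carrier_mat (dim_col D1) (dim_col A2)" "D2 \<in> carrier_mat (dim_col D1) (dim_col D2)"
    using assms by (intro carrier_matI; linarith)+
  then show ?thesis by (rule mult_four_block_mat)
qed

lemma four_block_plus:
  fixes A1 :: "'a :: monoid_add mat"
  assumes "dim_row B1 = dim_row A1" "dim_col C1 = dim_col A1" "dim_row D1 = dim_row C1" "dim_col D1 = dim_col B1"
    and "dim_row B2 = dim_row A2" "dim_col C2 = dim_col A2" "dim_row D2 = dim_row C2" "dim_col D2 = dim_col B2"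
    and "dim_row A1 = dim_row A2" "dim_col A1 = dim_col A2" "dim_row D1 = dim_row D2" "dim_col D1 = dim_col D2"
  shows "four_block_mat A1 B1 C1 D1 + four_block_mat A2 B2 C2 D2
    = four_block_mat (A1 + A2) (B1 + B2) (C1 + C2) (D1 + D2)"
proof -
  let ?r = "dim_row A1" and ?c = "dim_col A1" and ?s = "dim_row D1" and ?d = "dim_col D1"
  have c: "A1 \<in> carrier_mat ?r ?c" "B1 \<in> carrier_mat ?r ?d" "C1 \<in> carrier_mat ?s ?c" "D1 \<in> carrier_mat ?s ?d"
    "A2 \<in> carrier_mat ?r ?c" "B2 \<in> carrier_mat ?r ?d" "C2 \<in> carrier_mat ?s ?c" "D2 \<in> carrier_mat ?s ?d"
    using assms by (intro carrier_matI; linarith)+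
  then show ?thesis by (rule add_four_block_mat)
qed

lemma four_block_minus:
  fixes A1 :: "'a :: group_add mat"
  assumes "dim_row B1 = dim_row A1" "dim_col C1 = dim_col A1" "dim_row D1 = dim_row C1" "dim_col D1 = dim_col B1"
    and "dim_row B2 = dim_row A2" "dim_col C2 = dim_col A2" "dim_row D2 = dim_row C2" "dim_col D2 = dim_col B2"
    and "dim_row A1 = dim_row A2" "dim_col A1 = dim_col A2" "dim_row D1 = dim_row D2" "dim_col D1 = dim_col D2"
  shows "four_block_mat A1 B1 C1 D1 - four_block_mat A2 B2 C2 D2
    = four_block_mat (A1 - A2) (B1 - B2) (C1 - C2) (D1 - D2)"
proof -
  let ?r = "dim_row A1" and ?c = "dim_col A1" and ?s = "dim_row D1" and ?d = "dim_col D1"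
  have c: "A1 \<in> carrier_mat ?r ?c" "B1 \<in> carrier_mat ?r ?d" "C1 \<in> carrier_mat ?s ?c" "D1 \<in> carrier_mat ?s ?d"
    "A2 \<in> carrier_mat ?r ?c" "B2 \<in> carrier_mat ?r ?d" "C2 \<in> carrier_mat ?s ?c" "D2 \<in> carrier_mat ?s ?d"
    using assms by (intro carrier_matI; linarith)+
  show ?thesis by (intro eq_matI) (simp_all add: carrier_matD[OF c(2)] carrier_matD[OF c(3)]
    carrier_matD[OF c(5)] carrier_matD[OF c(6)] carrier_matD[OF c(7)] carrier_matD[OF c(8)])
qed

lemma four_block_eq_iff:
  assumes "dim_row B1 = dim_row A1" "dim_col C1 = dim_col A1" "dim_row D1 = dim_row C1" "dim_col D1 = dim_col B1"
    and "dim_row B2 = dim_row A2" "dim_col C2 = dim_col A2" "dim_row D2 = dim_row C2" "dim_col D2 = dim_col B2"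
    and "dim_row A1 = dim_row A2" "dim_col A1 = dim_col A2" "dim_row D1 = dim_row D2" "dim_col D1 = dim_col D2"
  shows "four_block_mat A1 B1 C1 D1 = four_block_mat A2 B2 C2 D2
    \<longleftrightarrow> A1 = A2 \<and> B1 = B2 \<and> C1 = C2 \<and> D1 = D2" (is "?L = ?R \<longleftrightarrow> _")
proof
  let ?r = "dim_row A1" and ?c = "dim_col A1" and ?s = "dim_row D1" and ?d = "dim_col D1"
  have c: "A1 \<in> carrier_mat ?r ?c" "B1 \<in> carrier_mat ?r ?d" "C1 \<in> carrier_mat ?s ?c" "D1 \<in> carrier_mat ?s ?d"
    "A2 \<in> carrier_mat ?r ?c" "B2 \<in> carrier_mat ?r ?d" "C2 \<in> carrier_mat ?s ?c" "D2 \<in> carrier_mat ?s ?d"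
    using assms by (intro carrier_matI; linarith)+
  note d [simp] = carrier_matD[OF c(2)] carrier_matD[OF c(3)]
    carrier_matD[OF c(5)] carrier_matD[OF c(6)] carrier_matD[OF c(7)] carrier_matD[OF c(8)]
  assume eq: "?L = ?R"
  have ent: "?L $$ (i,j) = ?R $$ (i,j)" for i j using eq by simp
  have "A1 = A2"
  proof (rule eq_matI)
    fix i j assume "i < dim_row A2" "j < dim_col A2"
    then show "A1 $$ (i,j) = A2 $$ (i,j)" using ent[of i j] by simp
  qed simp_all
  moreover have "B1 = B2"
  proof (rule eq_matI)
    fix i j assume "i < dim_row B2" "j < dim_col B2"
    then show "B1 $$ (i,j) = B2 $$ (i,j)" using ent[of i "?c + j"] by simp
  qed simp_all
  moreover have "C1 = C2"
  proof (rule eq_matI)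
    fix i j assume "i < dim_row C2" "j < dim_col C2"
    then show "C1 $$ (i,j) = C2 $$ (i,j)" using ent[of "?r + i" j] by simp
  qed simp_all
  moreover have "D1 = D2"
  proof (rule eq_matI)
    fix i j assume "i < dim_row D2" "j < dim_col D2"
    then show "D1 $$ (i,j) = D2 $$ (i,j)" using ent[of "?r + i" "?c + j"] by simp
  qed simp_all
  ultimately show "A1 = A2 \<and> B1 = B2 \<and> C1 = C2 \<and> D1 = D2" by simp
qed auto

lemma four_block_cases:
  assumes "A \<in> carrier_mat (r1 + r2) (c1 + c2)"
  obtains P Q R S where "P \<in> carrier_mat r1 c1" "Q \<in> carrier_mat r1 c2"
    "R \<in> carrier_mat r2 c1" "S \<in> carrier_mat r2 c2" "A = four_block_mat P Q R S"
proof -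
  obtain P Q R S where "split_block A r1 c1 = (P, Q, R, S)" by (metis surj_pair)
  moreover have "dim_row A = r1 + r2" "dim_col A = c1 + c2" using assms by auto
  ultimately show thesis using split_block[of A r1 c1 P Q R S r2 c2] by (intro that[of P Q R S])
qed

section \<open>Adjoints\<close>

lemma mat_adjoint_dim [simp]:
  "dim_row (mat_adjoint A) = dim_col A" "dim_col (mat_adjoint A) = dim_row A"
  unfolding mat_adjoint_def by auto

lemma mat_adjoint_carrier [simp]:
  "mat_adjoint A \<in> carrier_mat m k \<longleftrightarrow> A \<in> carrier_mat k m"
  using carrier_matD[of "mat_adjoint A" m k] carrier_matD[of A k m]
  by (auto intro!: carrier_matI)

lemma mat_adjoint_index [simp]:
  "i < dim_col A \<Longrightarrow> j < dim_row A \<Longrightarrow> mat_adjoint A $$ (i,j) = conjugate (A $$ (j,i))"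
  unfolding mat_adjoint_def by (simp add: mat_of_rows_index)

lemma mat_adjoint_adjoint [simp]: "mat_adjoint (mat_adjoint A) = A"
  by (auto intro!: eq_matI)

lemma mat_adjoint_mult:
  assumes "dim_col A = dim_row B"
  shows "mat_adjoint (A * B) = mat_adjoint B * mat_adjoint A"
proof (rule eq_matI)
  fix i j assume "i < dim_row (mat_adjoint B * mat_adjoint A)" "j < dim_col (mat_adjoint B * mat_adjoint A)"
  then have i: "i < dim_col B" and j: "j < dim_row A" by auto
  have "mat_adjoint (A * B) $$ (i,j) = conjugate (\<Sum>k = 0..<dim_row B. A $$ (j,k) * B $$ (k,i))"
    using i j assms by (simp add: scalar_prod_def)
  also have "\<dots> = (\<Sum>k = 0..<dim_row B. mat_adjoint B $$ (i,k) * mat_adjoint A $$ (k,j))"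
    using i j assms by (simp add: sum_conjugate conjugate_dist_mul mult.commute)
  also have "\<dots> = (mat_adjoint B * mat_adjoint A) $$ (i,j)"
    using i j assms by (simp add: scalar_prod_def)
  finally show "mat_adjoint (A * B) $$ (i,j) = (mat_adjoint B * mat_adjoint A) $$ (i,j)" .
qed auto

lemma mat_adjoint_zero [simp]: "mat_adjoint (0\<^sub>m m k) = 0\<^sub>m k m"
  by (intro eq_matI) auto

lemma mat_adjoint_one [simp]: "mat_adjoint (1\<^sub>m m :: complex mat) = 1\<^sub>m m"
  by (intro eq_matI) (auto simp: conjugate_complex_def)

lemma mat_adjoint_minus:
  "dim_row A = dim_row B \<Longrightarrow> dim_col A = dim_col B \<Longrightarrow>
    mat_adjoint (A - B :: complex mat) = mat_adjoint A - mat_adjoint B"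
  by (intro eq_matI) (auto simp: conjugate_complex_def)

lemma mat_adjoint_plus:
  "dim_row A = dim_row B \<Longrightarrow> dim_col A = dim_col B \<Longrightarrow>
    mat_adjoint (A + B :: complex mat) = mat_adjoint A + mat_adjoint B"
  by (intro eq_matI) (auto simp: conjugate_complex_def)

lemma mat_adjoint_four_block:
  assumes "dim_row B = dim_row A" "dim_col C = dim_col A" "dim_row D = dim_row C" "dim_col D = dim_col B"
  shows "mat_adjoint (four_block_mat A B C D) =
    four_block_mat (mat_adjoint A) (mat_adjoint C) (mat_adjoint B) (mat_adjoint D)"
  using assms by (intro eq_matI) (simp_all split: if_splits)

text \<open>The diagonal entry at \<open>(j,j)\<close> of the product is the sum of the squared
  moduli of column \<open>j\<close>.\<close>

lemma mat_adjoint_mult_self_eq_0: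
  fixes A :: "complex mat"
  assumes "mat_adjoint A * A = 0\<^sub>m (dim_col A) (dim_col A)"
  shows "A = 0\<^sub>m (dim_row A) (dim_col A)"
proof (rule eq_matI)
  fix i j assume ij: "i < dim_row (0\<^sub>m (dim_row A) (dim_col A) :: complex mat)"
    "j < dim_col (0\<^sub>m (dim_row A) (dim_col A) :: complex mat)"
  have "complex_of_real (\<Sum>k = 0..<dim_row A. (cmod (A $$ (k,j)))\<^sup>2) = (mat_adjoint A * A) $$ (j,j)"
    using ij by (simp add: scalar_prod_def conjugate_complex_def complex_norm_square mult.commute
        del: of_real_power)
  also have "\<dots> = 0" using ij unfolding assms by simp
  finally have "(\<Sum>k = 0..<dim_row A. (cmod (A $$ (k,j)))\<^sup>2) = 0" by (simp only: of_real_eq_0_iff)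
  then show "A $$ (i,j) = 0\<^sub>m (dim_row A) (dim_col A) $$ (i,j)"
    using ij by (simp add: sum_nonneg_eq_0_iff)
qed auto

section \<open>Ranks of products and of adjoints\<close>

lemma rk_mult_left:
  assumes "dim_col A = dim_row B"
  shows "rk (A * B) \<le> rk A"
proof -
  have A: "A \<in> carrier_mat (dim_row A) (dim_col A)" and B: "B \<in> carrier_mat (dim_col A) (dim_col B)"
    using assms by auto
  show ?thesis
    using vec_space.rank_mono[OF mult_carrier_mat[OF A B] A vec_space.col_space_mult_subset[OF A B]]
    by (simp only: index_mult_mat)
qed

text \<open>The column space of \<open>A * B\<close> lies in that of \<open>A\<close>, and equal
  ranks force them to coincide. This is the bridge from rank conditions to matrix equations.\<close>

lemma rk_mult_eq_imp_factor:
  assumes A: "A \<in> carrier_mat n m" and B: "B \<in> carrier_mat m k" and rk: "rk (A * B) = rk A"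
  shows "\<exists>Y \<in> carrier_mat k m. A = A * B * Y"
proof -
  have AB: "A * B \<in> carrier_mat n k" using A B by auto
  have "vec_space.rank n (A * B) = vec_space.rank n A"
    using rk A by (simp only: index_mult_mat carrier_matD)
  from vec_space.col_space_eqI_rank[OF AB A vec_space.col_space_mult_subset[OF A B] this]
  have "vec_space.col_space n A \<subseteq> vec_space.col_space n (A * B)" by simp
  from vec_space.col_space_subset_imp_factor[OF A AB this] show ?thesis .
qed

lemma rk_mult_le_inner:
  assumes "dim_col A = dim_row B"
  shows "rk (A * B) \<le> dim_col A"
proof -
  have A: "A \<in> carrier_mat (dim_row A) (dim_col A)" and B: "B \<in> carrier_mat (dim_col A) (dim_col B)"
    using assms by auto
  show ?thesis using vec_space.rank_mult_le_inner[OF A B] by (simp only: index_mult_mat)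
qed

text \<open>A full-rank factorisation of \<open>A\<close> makes its adjoint factor through dimension
  \<open>rk A\<close>, which bounds the rank from above; applied to the adjoint itself, the bound
  gives the converse.\<close>

lemma rk_adjoint: "rk (mat_adjoint A) = rk A"
proof -
  have le: "rk (mat_adjoint A) \<le> rk A" for A :: "complex mat"
  proof -
    have "A \<in> carrier_mat (dim_row A) (dim_col A)" by simp
    from vec_space.rank_factorization[OF this] obtain P Q where PQ: "P \<in> carrier_mat (dim_row A) (rk A)"
      "Q \<in> carrier_mat (rk A) (dim_col A)" and A: "A = P * Q" by blast
    have "mat_adjoint (P * Q) = mat_adjoint Q * mat_adjoint P" 
      using PQ by (auto intro: mat_adjoint_mult)
    then have "mat_adjoint A = mat_adjoint Q * mat_adjoint P" using A by simp
    moreover have "rk (mat_adjoint Q * mat_adjoint P) \<le> dim_col (mat_adjoint Q)"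
      using PQ by (intro rk_mult_le_inner) auto
    ultimately show ?thesis using PQ(2) by simp
  qed
  show ?thesis using le[of A] le[of "mat_adjoint A"] by (simp only: mat_adjoint_adjoint)
qed

lemma rk_mult_right:
  assumes "dim_col A = dim_row B"
  shows "rk (A * B) \<le> rk B"
proof -
  have "rk (A * B) = rk (mat_adjoint B * mat_adjoint A)"
    using rk_adjoint[of "A * B"] unfolding mat_adjoint_mult[OF assms] by (rule sym)
  also have "\<dots> \<le> rk (mat_adjoint B)" using assms by (intro rk_mult_left) auto
  also have "\<dots> = rk B" by (rule rk_adjoint)
  finally show ?thesis .
qed

section \<open>Unitary congruence and the minus order\<close>

lemma unitary_matD:
  assumes "unitary_mat U" "U \<in> carrier_mat n n"
  shows "U * mat_adjoint U = 1\<^sub>m n" "mat_adjoint U * U = 1\<^sub>m n"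
  using assms unfolding unitary_mat_def inverts_mat_def by auto

lemma unitary_matI:
  assumes U: "U \<in> carrier_mat n n" and eq: "mat_adjoint U * U = 1\<^sub>m n"
  shows "unitary_mat U"
  using mat_mult_left_right_inverse[OF _ U eq] U eq
  unfolding unitary_mat_def inverts_mat_def by auto

lemma unitary_mat_mult:
  assumes U: "U \<in> carrier_mat n n" "unitary_mat U" and V: "V \<in> carrier_mat n n" "unitary_mat V"
  shows "unitary_mat (U * V)"
proof (rule unitary_matI)
  note [simp] = carrier_matD[OF U(1)] carrier_matD[OF V(1)]
  have "mat_adjoint (U * V) * (U * V) = mat_adjoint V * ((mat_adjoint U * U) * V)"
    by (simp add: mat_adjoint_mult mat_mult_assoc)
  also have "\<dots> = 1\<^sub>m n" using unitary_matD[OF U(2,1)] unitary_matD[OF V(2,1)] by simp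
  finally show "mat_adjoint (U * V) * (U * V) = 1\<^sub>m n" .
qed (use U V in auto)

text \<open>For unitary \<open>U\<close> this is an automorphism of the matrix algebra that respects
  adjoints and ranks, so every notion in the theorem can be moved through it to the block
  matrices.\<close>

definition ucong :: "complex mat \<Rightarrow> complex mat \<Rightarrow> complex mat" where
  "ucong U X = U * X * mat_adjoint U"

lemma ucong_dim [simp]: "dim_row (ucong U X) = dim_row U" "dim_col (ucong U X) = dim_row U"
  unfolding ucong_def by auto

lemma ucong_carrier: "U \<in> carrier_mat n n \<Longrightarrow> ucong U X \<in> carrier_mat n n"
  by (intro carrier_matI) auto

lemma ucong_adjoint:
  assumes "U \<in> carrier_mat n n" "X \<in> carrier_mat n n"
  shows "mat_adjoint (ucong U X) = ucong U (mat_adjoint X)"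
  using carrier_matD[OF assms(1)] carrier_matD[OF assms(2)]
  unfolding ucong_def by (simp add: mat_adjoint_mult mat_mult_assoc)

lemma ucong_plus:
  assumes "U \<in> carrier_mat n n" "X \<in> carrier_mat n n" "Y \<in> carrier_mat n n"
  shows "ucong U X + ucong U Y = ucong U (X + Y)"
  using assms unfolding ucong_def
  by (simp add: mult_add_distrib_mat[of _ n n] add_mult_distrib_mat[of _ n n])

lemma ucong_minus:
  assumes "U \<in> carrier_mat n n" "X \<in> carrier_mat n n" "Y \<in> carrier_mat n n"
  shows "ucong U X - ucong U Y = ucong U (X - Y)"
  using assms unfolding ucong_def
  by (simp add: mult_minus_distrib_mat[of _ n n] minus_mult_distrib_mat[of _ n n])

lemma ucong_zero: "U \<in> carrier_mat n n \<Longrightarrow> ucong U (0\<^sub>m n n) = 0\<^sub>m n n"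
  unfolding ucong_def by auto

lemma ucong_ucong:
  assumes "U \<in> carrier_mat n n" "V \<in> carrier_mat n n" "X \<in> carrier_mat n n"
  shows "ucong U (ucong V X) = ucong (U * V) X"
  using carrier_matD[OF assms(1)] carrier_matD[OF assms(2)] carrier_matD[OF assms(3)]
  unfolding ucong_def by (simp add: mat_adjoint_mult mat_mult_assoc)

context
  fixes U :: "complex mat" and n :: nat
  assumes U: "U \<in> carrier_mat n n" and unitary: "unitary_mat U"
begin

lemma unitary_mat_cancel:
  assumes "dim_row Z = n"
  shows "mat_adjoint U * (U * Z) = Z" "U * (mat_adjoint U * Z) = Z"
  using assms carrier_matD[OF U] unitary_matD[OF unitary U]
  by (simp_all add: mat_mult_assoc[symmetric])

lemma ucong_mult:
  assumes "X \<in> carrier_mat n n" "Y \<in> carrier_mat n n"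
  shows "ucong U X * ucong U Y = ucong U (X * Y)"
  using carrier_matD[OF U] carrier_matD[OF assms(1)] carrier_matD[OF assms(2)]
  unfolding ucong_def by (simp add: mat_mult_assoc unitary_mat_cancel)

lemma ucong_one: "ucong U (1\<^sub>m n) = 1\<^sub>m n"
  using carrier_matD[OF U] unitary_matD[OF unitary U] unfolding ucong_def by simp

lemma ucong_pow:
  assumes X: "X \<in> carrier_mat n n"
  shows "ucong U X ^\<^sub>m k = ucong U (X ^\<^sub>m k)"
proof (induct k)
  case 0
  then show ?case using carrier_matD[OF X] carrier_matD[OF U] ucong_one by simp
next
  case (Suc k)
  then show ?case using ucong_mult[OF pow_carrier_mat[OF X] X] by simp
qed

lemma ucong_inverse:
  assumes X: "X \<in> carrier_mat n n"
  shows "mat_adjoint U * ucong U X * U = X"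
  using carrier_matD[OF U] carrier_matD[OF assms(1)] unitary_matD[OF unitary U]
  unfolding ucong_def by (simp add: mat_mult_assoc unitary_mat_cancel)

lemma ucong_surj:
  assumes A: "A \<in> carrier_mat n n"
  obtains X where "X \<in> carrier_mat n n" "A = ucong U X"
proof (rule that)
  show "mat_adjoint U * A * U \<in> carrier_mat n n" using A U by auto
  show "A = ucong U (mat_adjoint U * A * U)"
    using carrier_matD[OF U] carrier_matD[OF A] unitary_matD[OF unitary U]
    unfolding ucong_def by (simp add: mat_mult_assoc unitary_mat_cancel)
qed

lemma ucong_eq_iff:
  assumes "X \<in> carrier_mat n n" "Y \<in> carrier_mat n n"
  shows "ucong U X = ucong U Y \<longleftrightarrow> X = Y"
  using ucong_inverse[OF assms(1)] ucong_inverse[OF assms(2)] by metis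

lemma ucong_eq_zero_iff:
  assumes "X \<in> carrier_mat n n"
  shows "ucong U X = 0\<^sub>m n n \<longleftrightarrow> X = 0\<^sub>m n n"
  using ucong_eq_iff[OF assms, of "0\<^sub>m n n"] ucong_zero[OF U] by simp

lemma rk_ucong:
  assumes X: "X \<in> carrier_mat n n"
  shows "rk (ucong U X) = rk X"
proof (rule antisym)
  note [simp] = carrier_matD[OF U] carrier_matD[OF X]
  have "rk (U * X * mat_adjoint U) \<le> rk (U * X)" by (rule rk_mult_left) simp
  also have "\<dots> \<le> rk X" by (rule rk_mult_right) simp
  finally show "rk (ucong U X) \<le> rk X" unfolding ucong_def .
  have "rk X = rk (mat_adjoint U * ucong U X * U)" unfolding ucong_inverse[OF X] ..
  also have "\<dots> \<le> rk (mat_adjoint U * ucong U X)" by (rule rk_mult_left) simp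
  also have "\<dots> \<le> rk (ucong U X)" by (rule rk_mult_right) simp
  finally show "rk X \<le> rk (ucong U X)" .
qed

lemma minus_le_ucong:
  assumes X: "X \<in> carrier_mat n n" and Y: "Y \<in> carrier_mat n n"
  shows "minus_le (ucong U X) (ucong U Y) \<longleftrightarrow> minus_le X Y"
  using carrier_matD[OF X] carrier_matD[OF Y]
  unfolding minus_le_def ucong_minus[OF U Y X] rk_ucong[OF X] rk_ucong[OF Y]
    rk_ucong[OF minus_carrier_mat[OF X]] by simp

end

text \<open>
  Here and below, a \<open>2 \<times> 1\<close> or \<open>1 \<times> 2\<close> partition is a \<^const>\<open>four_block_mat\<close> with an empty
  second column or row.
\<close>

lemma rk_corner:
  assumes N: "N \<in> carrier_mat t t"
  shows "rk (four_block_mat (0\<^sub>m r r) (0\<^sub>m r t) (0\<^sub>m t r) N) = rk N" (is "rk ?C = _")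
proof (rule antisym)
  note [simp] = carrier_matD[OF N]
  \<comment> \<open>\<open>E\<close> embeds the last \<open>t\<close> coordinates and
    \<open>F\<close> projects onto them, so the corner matrix and \<open>N\<close> are obtained from
    each other by multiplication. \<open>pad\<close> gives \<open>N\<close> empty borders to make
    the block product rule applicable.\<close>
  define E :: "complex mat" where "E = four_block_mat (0\<^sub>m r t) (0\<^sub>m r 0) (1\<^sub>m t) (0\<^sub>m t 0)"
  define F :: "complex mat" where "F = four_block_mat (0\<^sub>m t r) (1\<^sub>m t) (0\<^sub>m 0 r) (0\<^sub>m 0 t)"
  have EF [simp]: "dim_row E = r + t" "dim_col E = t" "dim_row F = t" "dim_col F = r + t"
    unfolding E_def F_def by auto
  have pad: "N = four_block_mat N (0\<^sub>m t 0) (0\<^sub>m 0 t) (0\<^sub>m 0 0)"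
    by (intro eq_matI) auto
  have C: "?C = E * N * F"
    by (subst pad) (simp add: E_def F_def four_block_mult)
  have N_eq: "N = F * ?C * E"
    by (subst pad) (simp add: E_def F_def four_block_mult)
  have "rk (E * N * F) \<le> rk (E * N)" by (rule rk_mult_left) simp
  also have "\<dots> \<le> rk N" by (rule rk_mult_right) simp
  finally show "rk ?C \<le> rk N" unfolding C .
  have "rk (F * ?C * E) \<le> rk (F * ?C)" by (rule rk_mult_left) simp
  also have "\<dots> \<le> rk ?C" by (rule rk_mult_right) simp
  finally show "rk N \<le> rk ?C" unfolding N_eq[symmetric] .
qed

lemma minus_le_corner:
  assumes X: "X \<in> carrier_mat t t" and Y: "Y \<in> carrier_mat t t"
  shows "minus_le (four_block_mat (0\<^sub>m r r) (0\<^sub>m r t) (0\<^sub>m t r) X) (four_block_mat (0\<^sub>m r r) (0\<^sub>m r t) (0\<^sub>m t r) Y)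
    \<longleftrightarrow> minus_le X Y"
proof -
  note [simp] = carrier_matD[OF X] carrier_matD[OF Y]
  have zero_minus: "0\<^sub>m a b - 0\<^sub>m a b = (0\<^sub>m a b :: complex mat)" for a b
    by (intro eq_matI) auto
  have diff: "four_block_mat (0\<^sub>m r r) (0\<^sub>m r t) (0\<^sub>m t r) Y - four_block_mat (0\<^sub>m r r) (0\<^sub>m r t) (0\<^sub>m t r) X
    = four_block_mat (0\<^sub>m r r) (0\<^sub>m r t) (0\<^sub>m t r) (Y - X)"
    by (simp add: four_block_minus zero_minus)
  show ?thesis
    unfolding minus_le_def diff rk_corner[OF X] rk_corner[OF Y] rk_corner[OF minus_carrier_mat[OF X]]
    by simp
qed

text \<open>Full-rank factorisations of \<open>A\<close> and of \<open>B - A\<close> combine to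
  \<open>B = [P, P'] * [Q; Q']\<close>, whose inner dimension is
  \<open>rk A + rk (B - A) = rk B\<close>. Hence \<open>[P, P']\<close> has the same column space as
  \<open>B\<close>, which therefore contains that of \<open>P\<close> and of
  \<open>A\<close>.\<close>

lemma minus_le_imp_right_factor:
  assumes A: "A \<in> carrier_mat n m" and B: "B \<in> carrier_mat n m" and le: "minus_le A B"
  shows "\<exists>Y \<in> carrier_mat m m. A = B * Y"
proof -
  define a where "a = vec_space.rank n A"
  define c where "c = vec_space.rank n (B - A)"
  have BA: "B - A \<in> carrier_mat n m" using A by auto
  obtain P Q where P: "P \<in> carrier_mat n a" and Q: "Q \<in> carrier_mat a m" and PQ: "A = P * Q"
    using vec_space.rank_factorization[OF A] unfolding a_def by blast
  obtain P' Q' where P': "P' \<in> carrier_mat n c" and Q': "Q' \<in> carrier_mat c m" and PQ': "B - A = P' * Q'"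
    using vec_space.rank_factorization[OF BA] unfolding c_def by blast
  note [simp] = carrier_matD[OF A] carrier_matD[OF B] carrier_matD[OF P] carrier_matD[OF Q] 
    carrier_matD[OF P'] carrier_matD[OF Q']
  define R where "R = four_block_mat P P' (0\<^sub>m 0 a) (0\<^sub>m 0 c)"
  define S where "S = four_block_mat Q (0\<^sub>m a 0) Q' (0\<^sub>m c 0)"
  have R: "R \<in> carrier_mat n (a + c)" and S: "S \<in> carrier_mat (a + c) m"
    unfolding R_def S_def by (auto intro!: carrier_matI)
  have "R * S = four_block_mat (P * Q + P' * Q') (0\<^sub>m n 0) (0\<^sub>m 0 m) (0\<^sub>m 0 0)"
    unfolding R_def S_def by (simp add: four_block_mult)
  also have "P * Q + P' * Q' = B" unfolding PQ[symmetric] PQ'[symmetric] 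
    using A B by (intro eq_matI) auto
  also have "four_block_mat B (0\<^sub>m n 0) (0\<^sub>m 0 m) (0\<^sub>m 0 0) = B" by (intro eq_matI) auto
  finally have RS: "R * S = B" .
  have rkB: "rk B = a + c" using le unfolding minus_le_def a_def c_def by simp
  have "rk R \<le> a + c" using vec_space.rank_le_nc[OF R] carrier_matD[OF R] by simp
  moreover have "rk (R * S) \<le> rk R" using R S by (intro rk_mult_left) simp
  ultimately have "rk (R * S) = rk R" unfolding RS rkB by simp
  from rk_mult_eq_imp_factor[OF R S this] obtain Y where Y: "Y \<in> carrier_mat m (a + c)" "R = B * Y"
    unfolding RS by blast
  \<comment> \<open>Selects the first \<open>a\<close> columns of \<open>R\<close>, which form
    \<open>P\<close>.\<close>
  define E :: "complex mat" where "E = four_block_mat (1\<^sub>m a) (0\<^sub>m a 0) (0\<^sub>m c a) (0\<^sub>m c 0)"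
  have E: "E \<in> carrier_mat (a + c) a" unfolding E_def by (auto intro!: carrier_matI)
  have "R * E = four_block_mat P (0\<^sub>m n 0) (0\<^sub>m 0 a) (0\<^sub>m 0 0)"
    unfolding R_def E_def by (simp add: four_block_mult)
  also have "\<dots> = P" by (intro eq_matI) auto
  finally have "A = R * E * Q" using PQ by simp
  also have "\<dots> = B * (Y * E * Q)" unfolding Y(2)
    using carrier_matD[OF Y(1)] carrier_matD[OF E] by (simp add: mat_mult_assoc)
  finally show ?thesis using Y(1) E Q by (intro bexI[of _ "Y * E * Q"]) auto
qed

text \<open>Adjoints preserve rank and hence the minus order, and they exchange right and left
  factors.\<close>

lemma minus_le_imp_left_factor:
  assumes A: "A \<in> carrier_mat n m" and B: "B \<in> carrier_mat n m" and le: "minus_le A B"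
  shows "\<exists>W \<in> carrier_mat n n. A = W * B"
proof -
  note [simp] = carrier_matD[OF A] carrier_matD[OF B]
  have "minus_le (mat_adjoint A) (mat_adjoint B)"
    using le rk_adjoint[of A] rk_adjoint[of B] rk_adjoint[of "B - A"]
    unfolding minus_le_def by (simp add: mat_adjoint_minus)
  then obtain Y where Y: "Y \<in> carrier_mat n n" "mat_adjoint A = mat_adjoint B * Y"
    using minus_le_imp_right_factor[of "mat_adjoint A" m n "mat_adjoint B"] A B by auto
  have "A = mat_adjoint (mat_adjoint B * Y)" unfolding Y(2)[symmetric] by simp
  also have "\<dots> = mat_adjoint Y * B" using carrier_matD[OF Y(1)] by (simp add: mat_adjoint_mult)
  finally show ?thesis using Y(1) by (intro bexI[of _ "mat_adjoint Y"]) auto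
qed

text \<open>Unlike the rank condition, this equation can be compared block by block.\<close>

lemma core_invertible_iff:
  assumes A: "A \<in> carrier_mat n n"
  shows "A \<in> core_invertible n \<longleftrightarrow> (\<exists>X \<in> carrier_mat n n. A = A * A * X)"
proof
  assume "A \<in> core_invertible n"
  then have "rk (A * A) = rk A" unfolding core_invertible_def by simp
  from rk_mult_eq_imp_factor[OF A A this] show "\<exists>X \<in> carrier_mat n n. A = A * A * X" .
next
  assume "\<exists>X \<in> carrier_mat n n. A = A * A * X"
  then obtain X where X: "X \<in> carrier_mat n n" "A = A * A * X" by blast
  note [simp] = carrier_matD[OF A] carrier_matD[OF X(1)]
  have "rk (A * A) \<le> rk A" by (intro rk_mult_left) simp
  moreover have "rk (A * A * X) \<le> rk (A * A)" by (intro rk_mult_left) simp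
  ultimately have "rk (A * A) = rk A" unfolding X(2)[symmetric] by (rule antisym)
  then show "A \<in> core_invertible n" using A unfolding core_invertible_def by simp
qed

section \<open>Reduction of a singular matrix\<close>

lemma invertible_matI:
  assumes "A \<in> carrier_mat n n" "B \<in> carrier_mat n n" "A * B = 1\<^sub>m n" "B * A = 1\<^sub>m n"
  shows "invertible_mat A"
  using assms unfolding invertible_mat_def inverts_mat_def by auto

lemma invertible_matE:
  assumes inv: "invertible_mat A" and A: "A \<in> carrier_mat n n"
  obtains B where "B \<in> carrier_mat n n" "A * B = 1\<^sub>m n" "B * A = 1\<^sub>m n"
proof -
  obtain B where B: "A * B = 1\<^sub>m n" "B * A = 1\<^sub>m (dim_row B)"
    using inv A unfolding invertible_mat_def inverts_mat_def by auto
  \<comment> \<open>The definition of invertibility leaves the size of the inverse open; it is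
    recovered from the sizes of the two products.\<close>
  have "dim_col (A * B) = n" "dim_col (B * A) = dim_row B" unfolding B by auto
  then have "B \<in> carrier_mat n n" using A by (intro carrier_matI) auto
  then show thesis using that[of B] B by auto
qed

lemma invertible_mat_iff_det:
  fixes A :: "complex mat"
  assumes A: "A \<in> carrier_mat n n"
  shows "invertible_mat A \<longleftrightarrow> det A \<noteq> 0"
proof
  assume "invertible_mat A"
  then obtain B where B: "B \<in> carrier_mat n n" "A * B = 1\<^sub>m n" using invertible_matE[OF _ A] by metis
  then have "det A * det B = 1" using det_mult[OF A B(1)] by simp
  then show "det A \<noteq> 0" by auto
next
  assume "det A \<noteq> 0"
  \<comment> \<open>The value \<open>()\<close> merely fills the extension slot of the record of the
    matrix ring.\<close>
  from det_non_zero_imp_unit[OF A this, of "()"] show "invertible_mat A"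
    using A unfolding Units_def ring_mat_simps by (auto intro: invertible_matI)
qed

section \<open>Powers of a matrix\<close>

lemma pow_mat_add:
  fixes A :: "'a :: semiring_1 mat"
  assumes A: "A \<in> carrier_mat n n"
  shows "A ^\<^sub>m (j + k) = A ^\<^sub>m j * A ^\<^sub>m k"
proof (induct k)
  case (Suc k)
  have "A ^\<^sub>m j \<in> carrier_mat n n" "A ^\<^sub>m k \<in> carrier_mat n n" using A by auto
  then show ?case using Suc assoc_mult_mat[of "A ^\<^sub>m j" n n "A ^\<^sub>m k" n A n] A by simp
qed (use A in auto)

text \<open>Multiplying the assumption by \<open>A ^\<^sub>m m\<close> from the left raises the
  exponent by one at the price of a further right factor \<open>X\<close>. Thus a stable power can
  be pushed past any exponent, in particular past one at which a nilpotent part vanishes.\<close>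

lemma pow_factor_iterate:
  fixes A :: "'a :: semiring_1 mat"
  assumes A: "A \<in> carrier_mat n n" and X: "X \<in> carrier_mat n n" and eq: "A ^\<^sub>m k = A ^\<^sub>m (k + 1) * X"
  shows "\<exists>Z \<in> carrier_mat n n. A ^\<^sub>m k = A ^\<^sub>m (k + m) * Z"
proof (induct m)
  case 0
  show ?case using A by (intro bexI[of _ "1\<^sub>m n"]) auto
next
  case (Suc m)
  then obtain Z where Z: "Z \<in> carrier_mat n n" "A ^\<^sub>m k = A ^\<^sub>m (k + m) * Z" by auto
  have "A ^\<^sub>m (k + m) = A ^\<^sub>m m * (A ^\<^sub>m (k + 1) * X)"
    unfolding eq[symmetric] pow_mat_add[OF A, symmetric] by (simp add: add.commute)
  also have "\<dots> = A ^\<^sub>m m * A ^\<^sub>m (k + 1) * X"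
    by (rule assoc_mult_mat[symmetric, of _ n n _ n _ n]) (intro pow_carrier_mat A X)+
  also have "A ^\<^sub>m m * A ^\<^sub>m (k + 1) = A ^\<^sub>m (k + Suc m)"
    unfolding pow_mat_add[OF A, symmetric] by (simp add: add.commute)
  finally have step: "A ^\<^sub>m (k + m) = A ^\<^sub>m (k + Suc m) * X" .
  have "A ^\<^sub>m k = A ^\<^sub>m (k + Suc m) * X * Z" using Z(2) unfolding step .
  also have "\<dots> = A ^\<^sub>m (k + Suc m) * (X * Z)"
    by (rule assoc_mult_mat[of _ n n _ n _ n]) (intro pow_carrier_mat A X Z(1))+
  finally show ?case using X Z(1) by (intro bexI[of _ "X * Z"]) auto
qed

section \<open>Orthonormal bases with a prescribed last direction\<close>

definition normalize_vec :: "complex vec \<Rightarrow> complex vec" where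
  "normalize_vec w = complex_of_real (1 / sqrt (\<Sum>i<dim_vec w. (cmod (w $ i))\<^sup>2)) \<cdot>\<^sub>v w"

lemma normalize_vec_carrier [simp]: "w \<in> carrier_vec n \<Longrightarrow> normalize_vec w \<in> carrier_vec n"
  unfolding normalize_vec_def by simp

lemma normalize_vec_orth:
  assumes "w \<in> carrier_vec n" "u \<in> carrier_vec n" "w \<bullet>c u = 0"
  shows "normalize_vec w \<bullet>c normalize_vec u = 0"
  using assms unfolding normalize_vec_def by (simp add: conjugate_smult_vec)

lemma normalize_vec_self:
  assumes "w \<in> carrier_vec n" "w \<bullet>c w \<noteq> 0"
  shows "normalize_vec w \<bullet>c normalize_vec w = 1"
proof -
  define q where "q = (\<Sum>i<dim_vec w. (cmod (w $ i))\<^sup>2)"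
  have ww: "w \<bullet>c w = complex_of_real q"
    unfolding q_def scalar_prod_def
    by (simp add: conjugate_complex_def complex_norm_square atLeast0LessThan del: of_real_power)
  have "q \<ge> 0" unfolding q_def by (simp add: sum_nonneg)
  moreover have "q \<noteq> 0" using assms(2) ww by auto
  ultimately have q: "q > 0" by simp
  have "normalize_vec w \<bullet>c normalize_vec w = complex_of_real (1 / sqrt q) * (complex_of_real (1 / sqrt q) * (w \<bullet>c w))"
    using assms(1) unfolding normalize_vec_def q_def[symmetric]
    by (simp add: conjugate_smult_vec conjugate_complex_def)
  also have "\<dots> = complex_of_real (1 / sqrt q * (1 / sqrt q * q))" unfolding ww by (simp only: of_real_mult)
  also have "1 / sqrt q * (1 / sqrt q * q) = 1" using q by (simp add: field_simps)
  finally show ?thesis by simp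
qed

text \<open>Gram-Schmidt applied to a basis starting with \<open>v\<close> keeps \<open>v\<close>
  and yields orthogonal, not yet normalised, vectors; \<open>c\<close> is the normalising factor of
  \<open>v\<close>.\<close>

lemma ex_unitary_last_col:
  fixes v :: "complex vec"
  assumes v: "v \<in> carrier_vec (Suc m)" and v0: "v \<noteq> 0\<^sub>v (Suc m)"
  obtains U c where "U \<in> carrier_mat (Suc m) (Suc m)" "unitary_mat U" "col U m = c \<cdot>\<^sub>v v"
proof -
  let ?n = "Suc m"
  define ws where "ws = gram_schmidt ?n (basis_completion v)"
  interpret vec_space "TYPE(complex)" ?n .
  interpret cof_vec_space ?n "TYPE(complex)" .
  note bc = basis_completion[OF v v0]
  note gs = gram_schmidt_result[OF bc(2,4,5) ws_def]
  have len: "length ws = ?n" using gs(4) bc(6) by simp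
  obtain bs where "basis_completion v = v # bs" using bc(6,7) by (cases "basis_completion v") auto
  then have "hd ws = v" unfolding ws_def using gram_schmidt_hd[OF v] by simp
  then have ws0: "ws ! 0 = v" using len by (simp add: hd_conv_nth[symmetric] flip: length_greater_0_conv)
  have wsc: "ws ! i \<in> carrier_vec ?n" if "i < ?n" for i using gs(3) len that by auto
  \<comment> \<open>The index \<open>m - i\<close> reverses the list, since \<open>v\<close> stands
    first in it and is to become the last column.\<close>
  define U where "U = mat_of_cols ?n (map (\<lambda>i. normalize_vec (ws ! (m - i))) [0..<?n])"
  have U: "U \<in> carrier_mat ?n ?n" unfolding U_def by (auto intro!: carrier_matI)
  have colU: "col U i = normalize_vec (ws ! (m - i))" if "i < ?n" for i
    unfolding U_def using that wsc[of "m - i"]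
    by (subst col_mat_of_cols) (auto simp del: upt_Suc)
  have "mat_adjoint U * U = 1\<^sub>m ?n"
  proof (rule eq_matI)
    fix i j assume "i < dim_row (1\<^sub>m ?n :: complex mat)" "j < dim_col (1\<^sub>m ?n :: complex mat)"
    then have i: "i < ?n" and j: "j < ?n" by auto
    have "(mat_adjoint U * U) $$ (i,j) = conjugate (col U i) \<bullet> col U j"
      using i j U unfolding scalar_prod_def by (simp add: scalar_prod_def)
    also have "\<dots> = col U j \<bullet>c col U i"
      using i j U by (intro comm_scalar_prod[of _ ?n]) auto
    also have "\<dots> = (if i = j then 1 else 0)"
      using normalize_vec_self[OF wsc[of "m - j"]] normalize_vec_orth[OF wsc[of "m - j"] wsc[of "m - i"]]
        corthogonalD[OF gs(2), of "m - j" "m - i"] i j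
      unfolding colU[OF i] colU[OF j] len by auto
    finally show "(mat_adjoint U * U) $$ (i,j) = 1\<^sub>m ?n $$ (i,j)" using i j by simp
  qed (use U in auto)
  then have "unitary_mat U" by (rule unitary_matI[OF U])
  moreover have "\<exists>c. col U m = c \<cdot>\<^sub>v v" using colU[of m] ws0 unfolding normalize_vec_def by auto
  ultimately show thesis using that U by blast
qed

text \<open>The last row of \<open>Z\<close> is the conjugate of the last column of
  \<open>mat_adjoint Z\<close>, that is, of \<open>mat_adjoint U * mat_adjoint A\<close> applied to
  the last column of \<open>U\<close>. That column is a multiple of a kernel vector of
  \<open>mat_adjoint A\<close>, which is singular along with \<open>A\<close>.\<close>

lemma singular_ucong_last_row:
  fixes A :: "complex mat"
  assumes A: "A \<in> carrier_mat (Suc m) (Suc m)" and sing: "\<not> invertible_mat A"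
  obtains U X b where "U \<in> carrier_mat (Suc m) (Suc m)" "unitary_mat U"
    "X \<in> carrier_mat m m" "b \<in> carrier_mat m 1"
    "A = ucong U (four_block_mat X b (0\<^sub>m 1 m) (0\<^sub>m 1 1))"
proof -
  have A': "mat_adjoint A \<in> carrier_mat (Suc m) (Suc m)" using A by simp
  have "\<not> invertible_mat (mat_adjoint A)"
  proof
    assume "invertible_mat (mat_adjoint A)"
    then obtain B where B: "B \<in> carrier_mat (Suc m) (Suc m)"
      "mat_adjoint A * B = 1\<^sub>m (Suc m)" "B * mat_adjoint A = 1\<^sub>m (Suc m)"
      using invertible_matE[OF _ A'] by metis
    have "mat_adjoint B * A = mat_adjoint (mat_adjoint A * B)" "A * mat_adjoint B = mat_adjoint (B * mat_adjoint A)"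
      using A B(1) by (simp_all add: mat_adjoint_mult)
    then have "mat_adjoint B * A = 1\<^sub>m (Suc m)" "A * mat_adjoint B = 1\<^sub>m (Suc m)" unfolding B by simp_all
    with invertible_matI[OF A _ this(2,1)] B(1) sing show False by simp
  qed
  then obtain v where v: "v \<in> carrier_vec (Suc m)" "v \<noteq> 0\<^sub>v (Suc m)" "mat_adjoint A *\<^sub>v v = 0\<^sub>v (Suc m)"
    using invertible_mat_iff_det[OF A'] det_0_iff_vec_prod_zero[OF A'] by auto
  obtain U c where U: "U \<in> carrier_mat (Suc m) (Suc m)" "unitary_mat U" and c: "col U m = c \<cdot>\<^sub>v v"
    using ex_unitary_last_col[OF v(1,2)] by metis
  obtain Z where Z: "Z \<in> carrier_mat (Suc m) (Suc m)" and AZ: "A = ucong U Z"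
    using ucong_surj[OF U A] by metis
  have "mat_adjoint Z = mat_adjoint U * ucong U (mat_adjoint Z) * U"
    using ucong_inverse[OF U, of "mat_adjoint Z"] Z by simp
  also have "ucong U (mat_adjoint Z) = mat_adjoint A" using ucong_adjoint[OF U(1) Z] AZ by simp
  finally have Z': "mat_adjoint Z = mat_adjoint U * (mat_adjoint A * U)"
    using U(1) A by (simp add: mat_mult_assoc)
  have "col (mat_adjoint A * U) m = mat_adjoint A *\<^sub>v col U m" using U(1) A by (intro col_mult2[of _ "Suc m" "Suc m" _ "Suc m"]) auto
  also have "\<dots> = 0\<^sub>v (Suc m)" unfolding c mult_mat_vec[OF A' v(1)] v(3) by (intro eq_vecI) auto
  finally have "col (mat_adjoint Z) m = 0\<^sub>v (Suc m)" 
    unfolding Z' using U(1) A by (subst col_mult2[of _ "Suc m" "Suc m" _ "Suc m"]) auto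
  then have "mat_adjoint Z $$ (j,m) = 0" if "j < Suc m" for j
    using Z that by (metis carrier_matD col_def index_vec index_zero_vec(1) mat_adjoint_dim lessI)
  then have row0: "Z $$ (m,j) = 0" if "j < Suc m" for j
    using Z that by force
  have Z1: "Z \<in> carrier_mat (m + 1) (m + 1)" using Z by simp
  obtain X b R S where blocks: "X \<in> carrier_mat m m" "b \<in> carrier_mat m 1" "R \<in> carrier_mat 1 m" "S \<in> carrier_mat 1 1"
    and Zb: "Z = four_block_mat X b R S" using four_block_cases[OF Z1] by metis
  have "R = 0\<^sub>m 1 m"
  proof (rule eq_matI)
    fix i j assume "i < dim_row (0\<^sub>m 1 m :: complex mat)" "j < dim_col (0\<^sub>m 1 m :: complex mat)"
    then show "R $$ (i,j) = 0\<^sub>m 1 m $$ (i,j)" using row0[of j] blocks unfolding Zb by auto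
  qed (use blocks in auto)
  moreover have "S = 0\<^sub>m 1 1"
  proof (rule eq_matI)
    fix i j assume "i < dim_row (0\<^sub>m 1 1 :: complex mat)" "j < dim_col (0\<^sub>m 1 1 :: complex mat)"
    then show "S $$ (i,j) = 0\<^sub>m 1 1 $$ (i,j)" using row0[of m] blocks unfolding Zb by auto
  qed (use blocks in auto)
  ultimately show thesis using that[OF U blocks(1,2)] AZ Zb by simp
qed

section \<open>Block form of the core part\<close>

lemma nilpotent_mat_iff:
  "N \<in> carrier_mat t t \<Longrightarrow> nilpotent_mat N \<longleftrightarrow> (\<exists>k. N ^\<^sub>m k = 0\<^sub>m t t)"
  unfolding nilpotent_mat_def by auto

text \<open>In the closed form \<open>pow\<close> the border at exponent \<open>Suc k\<close> is
  \<open>N ^\<^sub>m k * c\<close>, so the bordered matrix vanishes at most one power later than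
  \<open>N\<close>.\<close>

lemma nilpotent_mat_border:
  assumes N: "N \<in> carrier_mat t t" and c: "c \<in> carrier_mat t 1" and nil: "nilpotent_mat N"
  shows "nilpotent_mat (four_block_mat N c (0\<^sub>m 1 t) (0\<^sub>m 1 1))" (is "nilpotent_mat ?F")
proof -
  note [simp] = carrier_matD[OF N] carrier_matD[OF c]
  have pow: "?F ^\<^sub>m Suc k = four_block_mat (N ^\<^sub>m Suc k) (N ^\<^sub>m k * c) (0\<^sub>m 1 t) (0\<^sub>m 1 1)" for k
  proof (induct k)
    case 0
    show ?case by simp
  next
    case (Suc k)
    have "?F ^\<^sub>m Suc (Suc k) = ?F ^\<^sub>m Suc k * ?F" by simp
    also have "\<dots> = four_block_mat (N ^\<^sub>m Suc (Suc k)) (N ^\<^sub>m Suc k * c) (0\<^sub>m 1 t) (0\<^sub>m 1 1)"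
      unfolding Suc by (simp add: four_block_mult)
    finally show ?case .
  qed
  obtain k where "N ^\<^sub>m k = 0\<^sub>m t t" using nil nilpotent_mat_iff[OF N] by auto
  then have "?F ^\<^sub>m Suc k = 0\<^sub>m (t + 1) (t + 1)" unfolding pow by simp
  moreover have "?F \<in> carrier_mat (t + 1) (t + 1)" by (rule carrier_matI) auto
  ultimately show ?thesis using nilpotent_mat_iff by blast
qed

lemma ucong_diag:
  assumes "V \<in> carrier_mat s s" "W \<in> carrier_mat t t"
    and "P \<in> carrier_mat s s" "Q \<in> carrier_mat s t" "R \<in> carrier_mat t s" "S \<in> carrier_mat t t"
  shows "ucong (four_block_mat V (0\<^sub>m s t) (0\<^sub>m t s) W) (four_block_mat P Q R S)
    = four_block_mat (ucong V P) (V * Q * mat_adjoint W) (W * R * mat_adjoint V) (ucong W S)"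
proof -
  note [simp] = assms[THEN carrier_matD(1)] assms[THEN carrier_matD(2)]
  show ?thesis unfolding ucong_def by (simp add: mat_adjoint_four_block four_block_mult)
qed

lemma unitary_mat_diag:
  assumes "V \<in> carrier_mat s s" "unitary_mat V" "W \<in> carrier_mat t t" "unitary_mat W"
  shows "four_block_mat V (0\<^sub>m s t) (0\<^sub>m t s) W \<in> carrier_mat (s + t) (s + t)"
    and "unitary_mat (four_block_mat V (0\<^sub>m s t) (0\<^sub>m t s) W)"
proof -
  note [simp] = carrier_matD[OF assms(1)] carrier_matD[OF assms(3)]
    unitary_matD[OF assms(2,1)] unitary_matD[OF assms(4,3)]
  show "four_block_mat V (0\<^sub>m s t) (0\<^sub>m t s) W \<in> carrier_mat (s + t) (s + t)" using assms by simp
  then show "unitary_mat (four_block_mat V (0\<^sub>m s t) (0\<^sub>m t s) W)"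
    by (rule unitary_matI) (simp add: mat_adjoint_four_block four_block_mult)
qed

lemma unitary_mat_one [simp]: "unitary_mat (1\<^sub>m n)"
  by (rule unitary_matI[of _ n]) auto

lemma core_EP_block_form:
  assumes "A \<in> carrier_mat n n"
  shows "\<exists>r t U T S N. n = r + t \<and> U \<in> carrier_mat n n \<and> unitary_mat U \<and>
    T \<in> carrier_mat r r \<and> invertible_mat T \<and> S \<in> carrier_mat r t \<and>
    N \<in> carrier_mat t t \<and> nilpotent_mat N \<and> A = ucong U (four_block_mat T S (0\<^sub>m t r) N)"
  using assms
proof (induct n arbitrary: A)
  case 0
  \<comment> \<open>In dimension zero all blocks are empty; the empty identity is also the zero
    matrix and can act both as \<open>T\<close> and as \<open>N\<close>.\<close>
  then have "A = ucong (1\<^sub>m 0) (four_block_mat (1\<^sub>m 0) (0\<^sub>m 0 0) (0\<^sub>m 0 0) (1\<^sub>m 0))"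
    by (intro eq_matI) auto
  moreover have "invertible_mat (1\<^sub>m 0 :: complex mat)" by (rule invertible_matI[of _ 0 "1\<^sub>m 0"]) auto
  moreover have "nilpotent_mat (1\<^sub>m 0)" unfolding nilpotent_mat_def by (auto intro!: exI[of _ 0] eq_matI)
  ultimately show ?case
    by (intro exI[of _ 0] exI[of _ "1\<^sub>m 0"] exI[of _ "0\<^sub>m 0 0"]) auto
next
  case (Suc m)
  note A = Suc(2)
  show ?case
  proof (cases "invertible_mat A")
    case True
    \<comment> \<open>A non-singular matrix is its own block \<open>T\<close>; the nilpotent corner
      is empty.\<close>
    have "A = ucong (1\<^sub>m (Suc m)) (four_block_mat A (0\<^sub>m (Suc m) 0) (0\<^sub>m 0 (Suc m)) (0\<^sub>m 0 0))"
      using A unfolding ucong_def by (intro eq_matI) auto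
    moreover have "nilpotent_mat (0\<^sub>m 0 0)" unfolding nilpotent_mat_def by (auto intro!: exI[of _ 0] eq_matI)
    ultimately show ?thesis using A True
      by (intro exI[of _ "Suc m"] exI[of _ 0] exI[of _ "1\<^sub>m (Suc m)"] exI[of _ A]
        exI[of _ "0\<^sub>m (Suc m) 0"] exI[of _ "0\<^sub>m 0 0"]) auto
  next
    case False
    then obtain U X b where U: "U \<in> carrier_mat (Suc m) (Suc m)" "unitary_mat U"
      and X: "X \<in> carrier_mat m m" and b: "b \<in> carrier_mat m 1"
      and A_eq: "A = ucong U (four_block_mat X b (0\<^sub>m 1 m) (0\<^sub>m 1 1))"
      using singular_ucong_last_row[OF A] by metis
    from Suc(1)[OF X] obtain r t V T S N where m: "m = r + t"
      and V: "V \<in> carrier_mat m m" "unitary_mat V" and T: "T \<in> carrier_mat r r" "invertible_mat T"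
      and S: "S \<in> carrier_mat r t" and N: "N \<in> carrier_mat t t" "nilpotent_mat N"
      and X_eq: "X = ucong V (four_block_mat T S (0\<^sub>m t r) N)" by metis
    let ?F = "four_block_mat T S (0\<^sub>m t r) N"
    \<comment> \<open>The border \<open>b\<close> seen in the basis given by \<open>V\<close>, so
      that conjugation with \<open>W\<close> turns \<open>c\<close> back into
      \<open>V * c = b\<close>.\<close>
    define c where "c = mat_adjoint V * b"
    define W where "W = four_block_mat V (0\<^sub>m m 1) (0\<^sub>m 1 m) (1\<^sub>m 1)"
    have W: "W \<in> carrier_mat (Suc m) (Suc m)" "unitary_mat W"
      using unitary_mat_diag[OF V, of "1\<^sub>m 1" 1] unfolding W_def by auto
    have F: "?F \<in> carrier_mat m m" unfolding m using T(1) N(1) by simp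
    have c: "c \<in> carrier_mat m 1" unfolding c_def using V b by simp
    have Vc: "V * c = b" unfolding c_def using unitary_mat_cancel(2)[OF V] b by simp
    have Z: "four_block_mat X b (0\<^sub>m 1 m) (0\<^sub>m 1 1) = ucong W (four_block_mat ?F c (0\<^sub>m 1 m) (0\<^sub>m 1 1))"
      unfolding W_def using ucong_diag[OF V(1) one_carrier_mat F c zero_carrier_mat zero_carrier_mat] V X_eq Vc b
      by (simp add: ucong_zero)
    \<comment> \<open>The new last column is cut at row \<open>r\<close>: its upper part extends
      \<open>S\<close>, its lower part \<open>c2\<close> borders the nilpotent block.\<close>
    define c2 where "c2 = mat t 1 (\<lambda>(i,j). c $$ (r + i,j))"
    define S' where "S' = mat r (t + 1) (\<lambda>(i,j). if j < t then S $$ (i,j) else c $$ (i,0))"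
    define N' where "N' = four_block_mat N c2 (0\<^sub>m 1 t) (0\<^sub>m 1 1)"
    have c2: "c2 \<in> carrier_mat t 1" unfolding c2_def by simp
    have N': "N' \<in> carrier_mat (t + 1) (t + 1)" "nilpotent_mat N'"
      unfolding N'_def using N nilpotent_mat_border[OF N(1) c2 N(2)] by auto
    \<comment> \<open>Both sides have the same entries; only the partition changes, from sizes
      \<open>(r + t) + 1\<close> to \<open>r + (t + 1)\<close>.\<close>
    have eq: "four_block_mat ?F c (0\<^sub>m 1 m) (0\<^sub>m 1 1) = four_block_mat T S' (0\<^sub>m (t + 1) r) N'"
      (is "?L = ?R")
    proof (rule eq_matI)
      note [simp] = carrier_matD[OF T(1)] carrier_matD[OF S] carrier_matD[OF N(1)] carrier_matD[OF c] m
      show "dim_row ?L = dim_row ?R" "dim_col ?L = dim_col ?R" unfolding N'_def c2_def by simp_all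
      fix i j assume "i < dim_row ?R" "j < dim_col ?R"
      then have i: "i < r + t + 1" and j: "j < r + t + 1" unfolding N'_def by simp_all
      consider "i < r" | "\<not> i < r" "i < r + t" | "\<not> i < r" "i = r + t" using i by linarith
      then show "?L $$ (i,j) = ?R $$ (i,j)"
      proof cases
        case 1
        show ?thesis
        proof (cases "j < r")
          case False
          then have "j - r < t + 1" using j by linarith
          then show ?thesis using 1 False j unfolding N'_def S'_def
            by (cases "j = r + t") (auto simp: less_Suc_eq)
        qed (use 1 in \<open>simp add: N'_def\<close>)
      next
        case 2
        then have ir: "i - r < t" "i - r < Suc t" by linarith+
        show ?thesis
        proof (cases "j < r")
          case False
          then have "j - r < Suc t" using j by linarith
          then show ?thesis using 2 ir False j unfolding N'_def c2_def
            by (cases "j = r + t") (auto simp: less_Suc_eq)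
        qed (use 2 ir in \<open>simp add: N'_def\<close>)
      next
        case 3
        show ?thesis
        proof (cases "j < r")
          case False
          then have "j - r < Suc t" using j by linarith
          then show ?thesis using 3 False j unfolding N'_def
            by (cases "j = r + t") (auto simp: less_Suc_eq)
        qed (use 3 in \<open>simp add: N'_def\<close>)
      qed
    qed
    have K: "four_block_mat ?F c (0\<^sub>m 1 m) (0\<^sub>m 1 1) \<in> carrier_mat (Suc m) (Suc m)"
      using carrier_matD[OF F] by (intro carrier_matI) simp_all
    have "A = ucong (U * W) (four_block_mat T S' (0\<^sub>m (t + 1) r) N')"
      using A_eq unfolding Z ucong_ucong[OF U(1) W(1) K] unfolding eq .
    moreover have "S' \<in> carrier_mat r (t + 1)" unfolding S'_def by simp
    moreover have "U * W \<in> carrier_mat (Suc m) (Suc m)" "unitary_mat (U * W)"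
      using U W unitary_mat_mult[OF U W] by auto
    moreover have "Suc m = r + (t + 1)" using m by simp
    ultimately show ?thesis using T N' by blast
  qed
qed

text \<open>Iterating \<open>N = N * N * Y\<close> makes \<open>N\<close> a left multiple of
  arbitrarily high powers of itself, up to right factors, and one of these powers is zero.\<close>

lemma nilpotent_core_invertible_imp_zero:
  assumes N: "N \<in> carrier_mat t t" "nilpotent_mat N" and ci: "N \<in> core_invertible t"
  shows "N = 0\<^sub>m t t"
proof -
  obtain Y where Y: "Y \<in> carrier_mat t t" "N = N * N * Y" using ci core_invertible_iff[OF N(1)] by metis
  obtain k where k: "N ^\<^sub>m k = 0\<^sub>m t t" using N nilpotent_mat_iff by metis
  have "N ^\<^sub>m 1 = N ^\<^sub>m (1 + 1) * Y" using N(1) Y(2) by simp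
  then obtain Z where Z: "Z \<in> carrier_mat t t" "N ^\<^sub>m 1 = N ^\<^sub>m (1 + k) * Z"
    using pow_factor_iterate[OF N(1) Y(1), of 1] by metis
  have "N ^\<^sub>m (1 + k) = 0\<^sub>m t t" using pow_mat_add[OF N(1), of 1 k] k N(1) by simp
  then show ?thesis using Z N(1) by simp
qed

lemma core_invertible_ucong:
  assumes U: "U \<in> carrier_mat n n" "unitary_mat U" and X: "X \<in> carrier_mat n n"
  shows "ucong U X \<in> core_invertible n \<longleftrightarrow> X \<in> core_invertible n"
proof -
  have "rk (ucong U X * ucong U X) = rk (X * X)"
    using ucong_mult[OF U X X] rk_ucong[OF U, of "X * X"] X by simp
  then show ?thesis using rk_ucong[OF U X] X ucong_carrier[OF U(1)]
    unfolding core_invertible_def by simp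
qed

text \<open>The lower right block of \<open>?F = ?F * ?F * X\<close> is exactly the corresponding
  equation for \<open>G\<close>. Conversely, a solution \<open>d\<close> for \<open>G\<close>
  extends to an upper triangular \<open>X\<close>, because \<open>T\<close> is invertible.\<close>

lemma core_invertible_upper_block:
  assumes T: "T \<in> carrier_mat r r" "invertible_mat T" and S: "S \<in> carrier_mat r t" and G: "G \<in> carrier_mat t t"
  shows "four_block_mat T S (0\<^sub>m t r) G \<in> core_invertible (r + t) \<longleftrightarrow> G \<in> core_invertible t"
    (is "?F \<in> _ \<longleftrightarrow> _")
proof -
  have F: "?F \<in> carrier_mat (r + t) (r + t)" using T G by simp
  obtain Ti where Ti: "Ti \<in> carrier_mat r r" "T * Ti = 1\<^sub>m r" "Ti * T = 1\<^sub>m r"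
    using invertible_matE[OF T(2,1)] by metis
  note [simp] = carrier_matD[OF T(1)] carrier_matD[OF S] carrier_matD[OF G] carrier_matD[OF Ti(1)]
  have FF: "?F * ?F = four_block_mat (T * T) (T * S + S * G) (0\<^sub>m t r) (G * G)"
    by (simp add: four_block_mult)
  show ?thesis unfolding core_invertible_iff[OF F] core_invertible_iff[OF G]
  proof
    assume "\<exists>X \<in> carrier_mat (r + t) (r + t). ?F = ?F * ?F * X"
    then obtain X where X: "X \<in> carrier_mat (r + t) (r + t)" "?F = ?F * ?F * X" by blast
    obtain a b c d where bl: "a \<in> carrier_mat r r" "b \<in> carrier_mat r t" "c \<in> carrier_mat t r" "d \<in> carrier_mat t t"
      and X_eq: "X = four_block_mat a b c d" using four_block_cases[OF X(1)] by metis
    note [simp] = bl[THEN carrier_matD(1)] bl[THEN carrier_matD(2)]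
    have "?F = four_block_mat (T * T * a + (T * S + S * G) * c) (T * T * b + (T * S + S * G) * d)
      (G * G * c) (G * G * d)"
      using X(2) unfolding FF X_eq by (simp add: four_block_mult)
    then have "G = G * G * d" by (subst (asm) four_block_eq_iff) auto
    then show "\<exists>X \<in> carrier_mat t t. G = G * G * X" using bl(4) by blast
  next
    assume "\<exists>X \<in> carrier_mat t t. G = G * G * X"
    then obtain d where d: "d \<in> carrier_mat t t" "G = G * G * d" by blast
    note [simp] = carrier_matD[OF d(1)]
    \<comment> \<open>Solution of the upper right equation
      \<open>T * T * b + (T * S + S * G) * d = S\<close>.\<close>
    define b where "b = Ti * (Ti * (S - (T * S + S * G) * d))"
    have b [simp]: "dim_row b = r" "dim_col b = t" unfolding b_def by auto
    have TTi: "T * (Ti * Z) = Z" if "dim_row Z = r" for Z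
      using that Ti(2) by (simp add: mat_mult_assoc[symmetric])
    have Tb: "T * T * b = S - (T * S + S * G) * d"
      unfolding b_def by (simp add: mat_mult_assoc TTi)
    have "T * T * Ti = T" using Ti(2) by (simp add: mat_mult_assoc)
    moreover have "T * T * b + (T * S + S * G) * d = S" unfolding Tb by (intro eq_matI) auto
    ultimately have "?F * ?F * four_block_mat Ti b (0\<^sub>m t r) d = ?F"
      unfolding FF using d(2)[symmetric] by (simp add: four_block_mult)
    moreover have "four_block_mat Ti b (0\<^sub>m t r) d \<in> carrier_mat (r + t) (r + t)" using Ti d by simp
    ultimately show "\<exists>X \<in> carrier_mat (r + t) (r + t). ?F = ?F * ?F * X" by metis
  qed
qed

lemma core_invertible_block_form:
  assumes ci: "A \<in> core_invertible n"
  shows "\<exists>r t U T S. n = r + t \<and> U \<in> carrier_mat n n \<and> unitary_mat U \<and>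
    T \<in> carrier_mat r r \<and> invertible_mat T \<and> S \<in> carrier_mat r t \<and>
    A = ucong U (four_block_mat T S (0\<^sub>m t r) (0\<^sub>m t t))"
proof -
  have A: "A \<in> carrier_mat n n" using ci unfolding core_invertible_def by simp
  from core_EP_block_form[OF A] obtain r t U T S N where n: "n = r + t"
    and U: "U \<in> carrier_mat n n" "unitary_mat U" and T: "T \<in> carrier_mat r r" "invertible_mat T"
    and S: "S \<in> carrier_mat r t" and N: "N \<in> carrier_mat t t" "nilpotent_mat N"
    and A_eq: "A = ucong U (four_block_mat T S (0\<^sub>m t r) N)" by metis
  have "four_block_mat T S (0\<^sub>m t r) N \<in> core_invertible (r + t)"
    using ci core_invertible_ucong[OF U, of "four_block_mat T S (0\<^sub>m t r) N"] T N unfolding A_eq n by simp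
  then have "N = 0\<^sub>m t t"
    using core_invertible_upper_block[OF T S N(1)] nilpotent_core_invertible_imp_zero[OF N] by simp
  then show ?thesis using n U T S A_eq by blast
qed

section \<open>Core inverse and core order\<close>

text \<open>\<open>A * X\<close> and \<open>A * Y\<close> are self-adjoint projectors with the same
  range, hence equal; \<open>X * A\<close> and \<open>Y * A\<close> agree in the same way, and
  \<open>X = X * A * X\<close> passes into \<open>Y * A * Y = Y\<close>.\<close>

lemma is_moore_penrose_unique:
  assumes X: "is_moore_penrose A X" and Y: "is_moore_penrose A Y"
  shows "X = Y"
proof -
  have Xc: "X \<in> carrier_mat (dim_col A) (dim_row A)" and X1: "A * X * A = A" and X2: "X * A * X = X"
    and X3: "mat_adjoint (A * X) = A * X" and X4: "mat_adjoint (X * A) = X * A"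
    using X unfolding is_moore_penrose_def by auto
  have Yc: "Y \<in> carrier_mat (dim_col A) (dim_row A)" and Y1: "A * Y * A = A" and Y2: "Y * A * Y = Y"
    and Y3: "mat_adjoint (A * Y) = A * Y" and Y4: "mat_adjoint (Y * A) = Y * A"
    using Y unfolding is_moore_penrose_def by auto
  note [simp] = carrier_matD[OF Xc] carrier_matD[OF Yc]
  have "A * X = (A * Y) * (A * X)"
    using Y1 by (metis mat_mult_assoc carrier_matD[OF Xc] carrier_matD[OF Yc] index_mult_mat(2,3))
  also have "\<dots> = mat_adjoint ((A * X) * (A * Y))"
    by (subst mat_adjoint_mult) (simp_all add: X3 Y3)
  also have "(A * X) * (A * Y) = A * Y"
    using X1 by (metis mat_mult_assoc carrier_matD[OF Xc] carrier_matD[OF Yc] index_mult_mat(2,3))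
  finally have AX: "A * X = A * Y" unfolding Y3 .
  have "X * A = (X * A) * (Y * A)"
    using Y1 by (metis mat_mult_assoc carrier_matD[OF Xc] carrier_matD[OF Yc] index_mult_mat(2,3))
  also have "\<dots> = mat_adjoint ((Y * A) * (X * A))"
    by (subst mat_adjoint_mult) (simp_all add: X4 Y4)
  also have "(Y * A) * (X * A) = Y * A"
    using X1 by (metis mat_mult_assoc carrier_matD[OF Xc] carrier_matD[OF Yc] index_mult_mat(2,3))
  finally have XA: "X * A = Y * A" unfolding Y4 .
  have "X = X * (A * X)" using X2 by (simp add: mat_mult_assoc)
  also have "\<dots> = (X * A) * Y" unfolding AX by (simp add: mat_mult_assoc)
  also have "\<dots> = Y" unfolding XA by (rule Y2)
  finally show ?thesis .
qed

lemma moore_penrose_eqI: "is_moore_penrose A X \<Longrightarrow> moore_penrose A = X"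
  unfolding moore_penrose_def by (blast intro: the_equality is_moore_penrose_unique)

lemma is_moore_penrose_ucong:
  assumes U: "U \<in> carrier_mat n n" "unitary_mat U" and F: "F \<in> carrier_mat n n" and X: "is_moore_penrose F X"
  shows "is_moore_penrose (ucong U F) (ucong U X)"
proof -
  have Xc: "X \<in> carrier_mat n n" using X F unfolding is_moore_penrose_def by auto
  note c = mult_carrier_mat[of _ n n _ n]
  show ?thesis
    using X F Xc carrier_matD[OF U(1)] unfolding is_moore_penrose_def
    by (simp add: ucong_mult[OF U] ucong_adjoint[OF U(1)] c ucong_carrier[OF U(1)])
qed

text \<open>The sum is \<open>mat_adjoint K * K\<close> for \<open>K\<close> consisting of the
  adjoints of \<open>T\<close> and \<open>S\<close> stacked. A kernel vector of it is annihilated by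
  \<open>K\<close>, in particular by the invertible adjoint of \<open>T\<close>.\<close>

lemma gram_sum_invertible:
  fixes T S :: "complex mat"
  assumes T: "T \<in> carrier_mat r r" "invertible_mat T" and S: "S \<in> carrier_mat r t"
  shows "invertible_mat (T * mat_adjoint T + S * mat_adjoint S)" (is "invertible_mat ?H")
proof (rule ccontr)
  note [simp] = carrier_matD[OF T(1)] carrier_matD[OF S]
  have H: "?H \<in> carrier_mat r r" by (intro carrier_matI) auto
  assume "\<not> invertible_mat ?H"
  then obtain v where v: "v \<in> carrier_vec r" "v \<noteq> 0\<^sub>v r" "?H *\<^sub>v v = 0\<^sub>v r"
    using invertible_mat_iff_det[OF H] det_0_iff_vec_prod_zero[OF H] by auto
  \<comment> \<open>The vector \<open>v\<close> as a one-column matrix, to which the rules for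
    blocks and adjoints apply.\<close>
  define V where "V = mat_of_cols r [v]"
  have [simp]: "dim_row V = r" "dim_col V = 1" unfolding V_def by auto
  have colV: "col V 0 = v" unfolding V_def using v by simp
  have HV: "?H * V = 0\<^sub>m r 1"
  proof (rule eq_matI)
    fix i j assume ij: "i < dim_row (0\<^sub>m r 1 :: complex mat)" "j < dim_col (0\<^sub>m r 1 :: complex mat)"
    then have "(?H * V) $$ (i,j) = (?H *\<^sub>v v) $ i" using colV by simp
    then show "(?H * V) $$ (i,j) = 0\<^sub>m r 1 $$ (i,j)" using v(3) ij by simp
  qed auto
  define K where "K = four_block_mat (mat_adjoint T) (0\<^sub>m r 0) (mat_adjoint S) (0\<^sub>m t 0)"
  have [simp]: "dim_row K = r + t" "dim_col K = r" unfolding K_def by auto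
  have "mat_adjoint K * K = four_block_mat ?H (0\<^sub>m r 0) (0\<^sub>m 0 r) (0\<^sub>m 0 0)"
    unfolding K_def by (simp add: mat_adjoint_four_block four_block_mult)
  also have "\<dots> = ?H" by (intro eq_matI) auto
  finally have KK: "mat_adjoint K * K = ?H" .
  have "mat_adjoint (K * V) * (K * V) = mat_adjoint V * ((mat_adjoint K * K) * V)"
    by (simp add: mat_adjoint_mult mat_mult_assoc)
  also have "\<dots> = 0\<^sub>m 1 1" unfolding KK HV by simp
  finally have "K * V = 0\<^sub>m (r + t) 1" using mat_adjoint_mult_self_eq_0[of "K * V"] by simp
  moreover have "K * V = four_block_mat (mat_adjoint T * V) (0\<^sub>m r 0) (mat_adjoint S * V) (0\<^sub>m t 0)"
  proof -
    have "V = four_block_mat V (0\<^sub>m r 0) (0\<^sub>m 0 1) (0\<^sub>m 0 0)" by (intro eq_matI) auto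
    then have "K * V = K * four_block_mat V (0\<^sub>m r 0) (0\<^sub>m 0 1) (0\<^sub>m 0 0)" by simp
    also have "\<dots> = four_block_mat (mat_adjoint T * V) (0\<^sub>m r 0) (mat_adjoint S * V) (0\<^sub>m t 0)"
      unfolding K_def by (simp add: four_block_mult)
    finally show ?thesis .
  qed
  moreover have "(0\<^sub>m (r + t) 1 :: complex mat) = four_block_mat (0\<^sub>m r 1) (0\<^sub>m r 0) (0\<^sub>m t 1) (0\<^sub>m t 0)"
    by (intro eq_matI) auto
  ultimately have "four_block_mat (mat_adjoint T * V) (0\<^sub>m r 0) (mat_adjoint S * V) (0\<^sub>m t 0)
    = four_block_mat (0\<^sub>m r 1) (0\<^sub>m r 0) (0\<^sub>m t 1) (0\<^sub>m t 0)" by simp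
  then have TV: "mat_adjoint T * V = 0\<^sub>m r 1" by (subst (asm) four_block_eq_iff) auto
  obtain Ti where Ti: "Ti \<in> carrier_mat r r" "T * Ti = 1\<^sub>m r"
    using invertible_matE[OF T(2,1)] by metis
  note [simp] = carrier_matD[OF Ti(1)]
  have "mat_adjoint Ti * mat_adjoint T = 1\<^sub>m r"
    using mat_adjoint_mult[of T Ti] Ti(2) by simp
  then have "V = mat_adjoint Ti * (mat_adjoint T * V)" by (simp add: mat_mult_assoc[symmetric])
  then have V0: "V = 0\<^sub>m r 1" unfolding TV by simp
  have "v = 0\<^sub>v r" unfolding colV[symmetric] V0 by (intro eq_vecI) auto
  with v(2) show False by simp
qed

text \<open>\<open>[T, S]\<close> has full row rank, so its Moore-Penrose inverse is its adjoint
  times \<open>G\<close>, the inverse of the Gram matrix \<open>?H\<close>; \<open>X\<close> pads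
  this with zeros. The product with \<open>X\<close> is the orthogonal projector onto the first
  \<open>r\<close> coordinates.\<close>

lemma moore_penrose_mult_block:
  fixes T S :: "complex mat"
  assumes T: "T \<in> carrier_mat r r" "invertible_mat T" and S: "S \<in> carrier_mat r t"
  obtains X where "is_moore_penrose (four_block_mat T S (0\<^sub>m t r) (0\<^sub>m t t)) X"
    "four_block_mat T S (0\<^sub>m t r) (0\<^sub>m t t) * X = four_block_mat (1\<^sub>m r) (0\<^sub>m r t) (0\<^sub>m t r) (0\<^sub>m t t)"
proof -
  note [simp] = carrier_matD[OF T(1)] carrier_matD[OF S]
  let ?F = "four_block_mat T S (0\<^sub>m t r) (0\<^sub>m t t)"
  let ?H = "T * mat_adjoint T + S * mat_adjoint S"
  have H: "?H \<in> carrier_mat r r" by (intro carrier_matI) auto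
  obtain G where G: "G \<in> carrier_mat r r" "?H * G = 1\<^sub>m r" "G * ?H = 1\<^sub>m r"
    using invertible_matE[OF gram_sum_invertible[OF T S] H] by metis
  note [simp] = carrier_matD[OF G(1)]
  \<comment> \<open>The inverse \<open>G\<close> inherits self-adjointness from \<open>?H\<close>;
    this makes \<open>X * ?F\<close> self-adjoint.\<close>
  have "mat_adjoint ?H = ?H" by (simp add: mat_adjoint_plus mat_adjoint_mult)
  then have "mat_adjoint G * ?H = 1\<^sub>m r" using mat_adjoint_mult[of ?H G] G(2) by simp
  then have "G = (mat_adjoint G * ?H) * G" by simp
  also have "\<dots> = mat_adjoint G * (?H * G)" by (rule mat_mult_assoc) auto
  finally have adjG: "mat_adjoint G = G" unfolding G(2) by simp
  define X where "X = four_block_mat (mat_adjoint T * G) (0\<^sub>m r t) (mat_adjoint S * G) (0\<^sub>m t t)"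
  have "?H * G = T * (mat_adjoint T * G) + S * (mat_adjoint S * G)"
    by (subst add_mult_distrib_mat[of _ r r _ _ r]) (auto simp: mat_mult_assoc G intro!: carrier_matI)
  then have FX: "?F * X = four_block_mat (1\<^sub>m r) (0\<^sub>m r t) (0\<^sub>m t r) (0\<^sub>m t t)"
    unfolding X_def using G(2) by (simp add: four_block_mult)
  have "X * ?F = four_block_mat (mat_adjoint T * G * T) (mat_adjoint T * G * S)
      (mat_adjoint S * G * T) (mat_adjoint S * G * S)"
    unfolding X_def by (simp add: four_block_mult)
  then have "mat_adjoint (X * ?F) = X * ?F"
    by (simp add: mat_adjoint_four_block mat_adjoint_mult adjG mat_mult_assoc)
  moreover have "mat_adjoint (?F * X) = ?F * X" unfolding FX by (simp add: mat_adjoint_four_block)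
  moreover have "?F * X * ?F = ?F" unfolding FX by (simp add: four_block_mult)
  moreover have "X * ?F * X = X * (?F * X)" by (rule mat_mult_assoc) (auto simp: X_def)
  moreover have "X * (?F * X) = X" unfolding FX unfolding X_def by (simp add: four_block_mult)
  moreover have "X \<in> carrier_mat (r + t) (r + t)" unfolding X_def by (intro carrier_matI) auto
  ultimately have "is_moore_penrose ?F X" unfolding is_moore_penrose_def by simp
  with FX that show thesis by blast
qed

text \<open>For uniqueness, the range condition makes a candidate \<open>Y\<close> factor through
  the given matrix, so in the basis \<open>U\<close> only its upper blocks \<open>p\<close> and
  \<open>q\<close> can be nonzero; the projector equation then reads \<open>T * p = 1\<close> and
  \<open>T * q = 0\<close>.\<close>

lemma core_inverse_block:
  assumes U: "U \<in> carrier_mat (r + t) (r + t)" "unitary_mat U"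
    and T: "T \<in> carrier_mat r r" and Ti: "Ti \<in> carrier_mat r r" "T * Ti = 1\<^sub>m r" "Ti * T = 1\<^sub>m r"
    and S: "S \<in> carrier_mat r t"
  shows "core_inverse (ucong U (four_block_mat T S (0\<^sub>m t r) (0\<^sub>m t t)))
    = ucong U (four_block_mat Ti (0\<^sub>m r t) (0\<^sub>m t r) (0\<^sub>m t t))"
proof -
  let ?n = "r + t"
  let ?F = "four_block_mat T S (0\<^sub>m t r) (0\<^sub>m t t)" and ?I = "four_block_mat Ti (0\<^sub>m r t) (0\<^sub>m t r) (0\<^sub>m t t)"
  let ?P = "four_block_mat (1\<^sub>m r) (0\<^sub>m r t) (0\<^sub>m t r) (0\<^sub>m t t) :: complex mat"
  note [simp] = carrier_matD[OF T(1)] carrier_matD[OF S] carrier_matD[OF Ti(1)] carrier_matD[OF U(1)]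
  have F: "?F \<in> carrier_mat ?n ?n" and I: "?I \<in> carrier_mat ?n ?n" and P: "?P \<in> carrier_mat ?n ?n"
    by (auto intro!: carrier_matI)
  let ?A = "ucong U ?F"
  have A: "?A \<in> carrier_mat ?n ?n" by (rule ucong_carrier[OF U(1)])
  have invT: "invertible_mat T" using invertible_matI[OF T Ti] .
  obtain X where X: "is_moore_penrose ?F X" "?F * X = ?P"
    using moore_penrose_mult_block[OF T invT S] by metis
  have Xc: "X \<in> carrier_mat ?n ?n" using X(1) unfolding is_moore_penrose_def by simp
  have "moore_penrose ?A = ucong U X"
    by (rule moore_penrose_eqI[OF is_moore_penrose_ucong[OF U F X(1)]])
  then have Amp: "?A * moore_penrose ?A = ucong U ?P"
    using ucong_mult[OF U F Xc] X(2) by simp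
  show ?thesis unfolding core_inverse_def Amp
  proof (rule the_equality, intro conjI)
    show "ucong U ?I \<in> carrier_mat (dim_row ?A) (dim_row ?A)" using ucong_carrier[OF U(1)] by simp
    show "?A * ucong U ?I = ucong U ?P"
      unfolding ucong_mult[OF U F I] using Ti by (simp add: four_block_mult)
    \<comment> \<open>Witness for the range inclusion: \<open>?F * J = ?I\<close>.\<close>
    define J where "J = four_block_mat (Ti * Ti) (0\<^sub>m r t) (0\<^sub>m t r) (0\<^sub>m t t)"
    have J: "J \<in> carrier_mat ?n ?n" unfolding J_def by (auto intro!: carrier_matI)
    have "?F * J = ?I" unfolding J_def using Ti by (simp add: four_block_mult mat_mult_assoc[symmetric])
    then have eq: "ucong U ?I = ?A * ucong U J" using ucong_mult[OF U F J] by simp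
    show "range_mat (ucong U ?I) \<subseteq> range_mat ?A"
      using vec_space.col_space_mult_subset[OF A ucong_carrier[OF U(1), of J]] unfolding eq[symmetric] by simp
  next
    fix Y assume Y: "Y \<in> carrier_mat (dim_row ?A) (dim_row ?A) \<and> ?A * Y = ucong U ?P \<and> range_mat Y \<subseteq> range_mat ?A"
    then have Yc: "Y \<in> carrier_mat ?n ?n" and AY: "?A * Y = ucong U ?P" by auto
    have "vec_space.col_space ?n Y \<subseteq> vec_space.col_space ?n ?A" using Y carrier_matD[OF Yc] by simp
    then obtain W where W: "W \<in> carrier_mat ?n ?n" "Y = ?A * W"
      using vec_space.col_space_subset_imp_factor[OF Yc A] by blast
    obtain W' where W': "W' \<in> carrier_mat ?n ?n" "W = ucong U W'" using ucong_surj[OF U W(1)] by metis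
    obtain a b c d where bl: "a \<in> carrier_mat r r" "b \<in> carrier_mat r t" "c \<in> carrier_mat t r" "d \<in> carrier_mat t t"
      and W'_eq: "W' = four_block_mat a b c d" using four_block_cases[OF W'(1)] by metis
    note [simp] = bl[THEN carrier_matD(1)] bl[THEN carrier_matD(2)]
    define p where "p = T * a + S * c"
    define q where "q = T * b + S * d"
    have [simp]: "dim_row p = r" "dim_col p = r" "dim_row q = r" "dim_col q = t" unfolding p_def q_def by auto
    have FW: "?F * W' = four_block_mat p q (0\<^sub>m t r) (0\<^sub>m t t)"
      unfolding W'_eq p_def q_def by (simp add: four_block_mult)
    have Y_eq: "Y = ucong U (four_block_mat p q (0\<^sub>m t r) (0\<^sub>m t t))"
      unfolding W(2) W'(2) ucong_mult[OF U F W'(1)] FW ..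
    have pq: "four_block_mat p q (0\<^sub>m t r) (0\<^sub>m t t) \<in> carrier_mat ?n ?n" by (auto intro!: carrier_matI)
    have "ucong U (?F * four_block_mat p q (0\<^sub>m t r) (0\<^sub>m t t)) = ucong U ?P"
      using AY unfolding Y_eq ucong_mult[OF U F pq] .
    then have "?F * four_block_mat p q (0\<^sub>m t r) (0\<^sub>m t t) = ?P"
      using ucong_eq_iff[OF U mult_carrier_mat[OF F pq] P] by simp
    then have "four_block_mat (T * p) (T * q) (0\<^sub>m t r) (0\<^sub>m t t) = ?P"
      by (simp add: four_block_mult)
    then have Tp: "T * p = 1\<^sub>m r" and Tq: "T * q = 0\<^sub>m r t" by (subst (asm) four_block_eq_iff, auto)+
    have "p = Ti * (T * p)" "q = Ti * (T * q)" using Ti(3) by (simp_all add: mat_mult_assoc[symmetric])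
    then have "p = Ti" "q = 0\<^sub>m r t" unfolding Tp Tq by simp_all
    then show "Y = ucong U ?I" unfolding Y_eq by simp
  qed
qed

text \<open>Multiplying by the core inverse from the left compares the first block rows, from the
  right the first block columns, and the invertible factors \<open>T\<close> and \<open>Ti\<close>
  cancel. The block \<open>E4\<close> is seen by neither equation.\<close>

lemma core_le_block_iff:
  assumes U: "U \<in> carrier_mat (r + t) (r + t)" "unitary_mat U"
    and T: "T \<in> carrier_mat r r" "invertible_mat T" and S: "S \<in> carrier_mat r t"
    and E: "E1 \<in> carrier_mat r r" "E2 \<in> carrier_mat r t" "E3 \<in> carrier_mat t r" "E4 \<in> carrier_mat t t"
    and ci: "ucong U (four_block_mat T S (0\<^sub>m t r) (0\<^sub>m t t)) \<in> core_invertible (r + t)"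
      "ucong U (four_block_mat E1 E2 E3 E4) \<in> core_invertible (r + t)"
  shows "core_le (r + t) (ucong U (four_block_mat T S (0\<^sub>m t r) (0\<^sub>m t t))) (ucong U (four_block_mat E1 E2 E3 E4))
    \<longleftrightarrow> E1 = T \<and> E2 = S \<and> E3 = 0\<^sub>m t r"
proof -
  let ?n = "r + t"
  obtain Ti where Ti: "Ti \<in> carrier_mat r r" "T * Ti = 1\<^sub>m r" "Ti * T = 1\<^sub>m r"
    using invertible_matE[OF T(2,1)] by metis
  let ?F = "four_block_mat T S (0\<^sub>m t r) (0\<^sub>m t t)" and ?I = "four_block_mat Ti (0\<^sub>m r t) (0\<^sub>m t r) (0\<^sub>m t t)"
    and ?E = "four_block_mat E1 E2 E3 E4"
  note [simp] = carrier_matD[OF T(1)] carrier_matD[OF S] carrier_matD[OF Ti(1)]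
    E[THEN carrier_matD(1)] E[THEN carrier_matD(2)]
  have F: "?F \<in> carrier_mat ?n ?n" and I: "?I \<in> carrier_mat ?n ?n" and Ec: "?E \<in> carrier_mat ?n ?n"
    by (auto intro!: carrier_matI)
  have "?I * ?F = ?I * ?E \<longleftrightarrow> Ti * T = Ti * E1 \<and> Ti * S = Ti * E2"
    by (simp add: four_block_mult four_block_eq_iff)
  also have "\<dots> \<longleftrightarrow> E1 = T \<and> E2 = S"
  proof
    assume eq: "Ti * T = Ti * E1 \<and> Ti * S = Ti * E2"
    have "T * (Ti * T) = T * (Ti * E1)" "T * (Ti * S) = T * (Ti * E2)" using eq by simp_all
    then show "E1 = T \<and> E2 = S" using Ti(2) by (simp add: mat_mult_assoc[symmetric])
  qed simp
  finally have 1: "?I * ?F = ?I * ?E \<longleftrightarrow> E1 = T \<and> E2 = S" .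
  have "?F * ?I = ?E * ?I \<longleftrightarrow> T * Ti = E1 * Ti \<and> 0\<^sub>m t r = E3 * Ti"
    by (simp add: four_block_mult four_block_eq_iff)
  also have "\<dots> \<longleftrightarrow> E1 = T \<and> E3 = 0\<^sub>m t r"
  proof
    assume eq: "T * Ti = E1 * Ti \<and> 0\<^sub>m t r = E3 * Ti"
    have "T * Ti * T = E1 * Ti * T" "0\<^sub>m t r * T = E3 * Ti * T" using eq by simp_all
    then show "E1 = T \<and> E3 = 0\<^sub>m t r" using Ti(3) by (simp add: mat_mult_assoc)
  qed simp
  finally have 2: "?F * ?I = ?E * ?I \<longleftrightarrow> E1 = T \<and> E3 = 0\<^sub>m t r" .
  have inv: "core_inverse (ucong U ?F) = ucong U ?I" by (rule core_inverse_block[OF U T(1) Ti S])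
  show ?thesis unfolding core_le_def inv ucong_mult[OF U I F] ucong_mult[OF U I Ec] ucong_mult[OF U F I] ucong_mult[OF U Ec I]
      ucong_eq_iff[OF U mult_carrier_mat[OF I F] mult_carrier_mat[OF I Ec]]
      ucong_eq_iff[OF U mult_carrier_mat[OF F I] mult_carrier_mat[OF Ec I]] 1 2
    using ci by auto
qed

section \<open>Core-EP decompositions in block form\<close>

lemma nilpotent_mat_ucong:
  assumes U: "U \<in> carrier_mat n n" "unitary_mat U" and X: "X \<in> carrier_mat n n"
  shows "nilpotent_mat (ucong U X) \<longleftrightarrow> nilpotent_mat X"
  unfolding nilpotent_mat_iff[OF X] nilpotent_mat_iff[OF ucong_carrier[OF U(1)]] ucong_pow[OF U X]
    ucong_eq_zero_iff[OF U pow_carrier_mat[OF X]] ..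

lemma nilpotent_mat_corner:
  assumes N: "N \<in> carrier_mat t t"
  shows "nilpotent_mat (four_block_mat (0\<^sub>m r r) (0\<^sub>m r t) (0\<^sub>m t r) N) \<longleftrightarrow> nilpotent_mat N"
    (is "nilpotent_mat ?C \<longleftrightarrow> _")
proof -
  note [simp] = carrier_matD[OF N]
  have C: "?C \<in> carrier_mat (r + t) (r + t)" by (intro carrier_matI) auto
  \<comment> \<open>Exponent zero is left out, since the zeroth power has an identity in the upper
    corner.\<close>
  have pow: "?C ^\<^sub>m Suc k = four_block_mat (0\<^sub>m r r) (0\<^sub>m r t) (0\<^sub>m t r) (N ^\<^sub>m Suc k)" for k
    unfolding pow_four_block_mat[OF zero_carrier_mat N] by simp
  show ?thesis unfolding nilpotent_mat_iff[OF C] nilpotent_mat_iff[OF N]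
  proof
    assume "\<exists>k. ?C ^\<^sub>m k = 0\<^sub>m (r + t) (r + t)"
    then obtain k where "?C ^\<^sub>m k = 0\<^sub>m (r + t) (r + t)" ..
    then have "?C ^\<^sub>m Suc k = 0\<^sub>m (r + t) (r + t)" by simp
    then have "four_block_mat (0\<^sub>m r r) (0\<^sub>m r t) (0\<^sub>m t r) (N ^\<^sub>m Suc k)
      = four_block_mat (0\<^sub>m r r) (0\<^sub>m r t) (0\<^sub>m t r) (0\<^sub>m t t)" unfolding pow by simp
    then have "N ^\<^sub>m Suc k = 0\<^sub>m t t" by (subst (asm) four_block_eq_iff) auto
    then show "\<exists>k. N ^\<^sub>m k = 0\<^sub>m t t" by blast
  next
    assume "\<exists>k. N ^\<^sub>m k = 0\<^sub>m t t"
    then obtain k where "N ^\<^sub>m k = 0\<^sub>m t t" ..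
    then have "?C ^\<^sub>m Suc k = 0\<^sub>m (r + t) (r + t)" unfolding pow by simp
    then show "\<exists>k. ?C ^\<^sub>m k = 0\<^sub>m (r + t) (r + t)" by blast
  qed
qed

text \<open>At index zero the factor is the inverse of \<open>A\<close>; otherwise it comes from the
  equality of ranks that defines the index.\<close>

lemma pow_matrix_index_factor:
  assumes A: "A \<in> carrier_mat n n"
  shows "\<exists>X \<in> carrier_mat n n. A ^\<^sub>m matrix_index A = A ^\<^sub>m (matrix_index A + 1) * X"
proof (cases "invertible_mat A")
  case True
  then obtain B where "B \<in> carrier_mat n n" "A * B = 1\<^sub>m n" using invertible_matE[OF _ A] by metis
  then show ?thesis using True A unfolding matrix_index_def by (intro bexI[of _ B]) auto
next
  case False
  have le: "rk (A ^\<^sub>m (k + 1)) \<le> rk (A ^\<^sub>m k)" for k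
    using rk_mult_left[of "A ^\<^sub>m k" A] A by simp
  \<comment> \<open>At a positive exponent of minimal rank the next power cannot have smaller rank,
    so the set whose least element is the index is inhabited.\<close>
  obtain k where k: "0 < k" and least: "\<And>j. 0 < j \<Longrightarrow> rk (A ^\<^sub>m k) \<le> rk (A ^\<^sub>m j)"
    using ex_has_least_nat[of "\<lambda>k. 0 < k" 1 "\<lambda>k. rk (A ^\<^sub>m k)"] by auto
  have "rk (A ^\<^sub>m (k + 1)) = rk (A ^\<^sub>m k)" by (rule antisym[OF le least]) simp
  with k have "0 < k \<and> rk (A ^\<^sub>m (k + 1)) = rk (A ^\<^sub>m k)" ..
  from LeastI[of "\<lambda>k. 0 < k \<and> rk (A ^\<^sub>m (k + 1)) = rk (A ^\<^sub>m k)", OF this]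
  have "rk (A ^\<^sub>m (matrix_index A + 1)) = rk (A ^\<^sub>m matrix_index A)"
    using False unfolding matrix_index_def by simp
  then have "rk (A ^\<^sub>m matrix_index A * A) = rk (A ^\<^sub>m matrix_index A)" by simp
  from rk_mult_eq_imp_factor[OF pow_carrier_mat[OF A] A this] show ?thesis by simp
qed

text \<open>
  The matrix \<open>P\<close> stands for the projector onto the orthogonal complement of the range of \<open>A1\<close>: it turns
  \<open>A ^\<^sub>m k\<close> into \<open>A2 ^\<^sub>m k\<close>, so that a power of \<open>A\<close> whose rank is stable yields a vanishing power of \<open>A2\<close>.
\<close>

lemma core_EP_decompositionI:
  assumes A1: "A1 \<in> core_invertible n" and A2: "A2 \<in> carrier_mat n n" "nilpotent_mat A2"
    and P: "P \<in> carrier_mat n n" "P * A1 = 0\<^sub>m n n" "P * A2 = A2"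
    and orth: "mat_adjoint A1 * A2 = 0\<^sub>m n n" "A2 * A1 = 0\<^sub>m n n"
  shows "core_EP_decomposition n (A1 + A2) A1 A2"
proof -
  define A where "A = A1 + A2"
  have A1c: "A1 \<in> carrier_mat n n" using A1 unfolding core_invertible_def by simp
  have A: "A \<in> carrier_mat n n" unfolding A_def using A2 by simp
  note [simp] = carrier_matD[OF A1c] carrier_matD[OF A2(1)] carrier_matD[OF P(1)] carrier_matD[OF A]
  have PA: "P * A = A2" unfolding A_def using mult_add_distrib_mat[OF P(1) A1c A2(1)] P by simp
  have A2A: "A2 * A = A2 * A2" unfolding A_def using mult_add_distrib_mat[OF A2(1) A1c A2(1)] orth by simp
  have pow: "P * A ^\<^sub>m Suc j = A2 ^\<^sub>m Suc j" for j
  proof (induct j)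
    case (Suc j)
    have "P * A ^\<^sub>m Suc (Suc j) = (P * A ^\<^sub>m Suc j) * A" by (simp add: mat_mult_assoc)
    also have "\<dots> = A2 ^\<^sub>m j * (A2 * A)" unfolding Suc by (simp add: mat_mult_assoc)
    also have "\<dots> = A2 ^\<^sub>m Suc (Suc j)" unfolding A2A by (simp add: mat_mult_assoc)
    finally show ?case .
  qed (simp add: PA)
  let ?k = "matrix_index A"
  obtain m where m: "A2 ^\<^sub>m m = 0\<^sub>m n n" using A2 nilpotent_mat_iff by metis
  obtain X where X: "X \<in> carrier_mat n n" "A ^\<^sub>m ?k = A ^\<^sub>m (?k + 1) * X"
    using pow_matrix_index_factor[OF A] by metis
  \<comment> \<open>The exponent goes past \<open>m\<close>, where \<open>A2\<close> vanishes;
    \<open>Suc\<close> keeps it positive, as \<open>pow\<close> requires.\<close>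
  obtain Z where Z: "Z \<in> carrier_mat n n" "A ^\<^sub>m ?k = A ^\<^sub>m (?k + Suc m) * Z"
    using pow_factor_iterate[OF A X] by metis
  note [simp] = carrier_matD[OF Z(1)]
  have A2m: "A2 ^\<^sub>m Suc (?k + m) = 0\<^sub>m n n"
    using pow_mat_add[OF A2(1), of "Suc ?k" m] m by simp
  have "P * A ^\<^sub>m ?k = P * (A ^\<^sub>m Suc (?k + m) * Z)" using Z(2) by (metis add_Suc_right)
  also have "\<dots> = (P * A ^\<^sub>m Suc (?k + m)) * Z" by (rule mat_mult_assoc[symmetric]) simp_all
  also have "\<dots> = 0\<^sub>m n n" unfolding pow A2m by simp
  finally have zero: "P * A ^\<^sub>m ?k = 0\<^sub>m n n" .
  have "if ?k = 0 then A2 = 0\<^sub>m n n else A2 ^\<^sub>m ?k = 0\<^sub>m n n"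
  proof (cases ?k)
    \<comment> \<open>The power in \<open>zero\<close> is the identity, so \<open>P\<close>
      vanishes, and with it \<open>A2 = P * A2\<close>.\<close>
    case 0
    then have "P = 0\<^sub>m n n" using zero by simp
    then have "A2 = 0\<^sub>m n n" using P(3) by simp
    with 0 show ?thesis by simp
  next
    case (Suc j)
    then show ?thesis using zero pow[of j] by simp
  qed
  then show ?thesis unfolding core_EP_decomposition_def A_def[symmetric] using A1 A2 orth by simp
qed

lemma core_EP_decomposition_nilpotent:
  assumes "core_EP_decomposition n A A1 A2"
  shows "nilpotent_mat A2"
proof -
  have A2: "A2 \<in> carrier_mat n n" using assms unfolding core_EP_decomposition_def by simp
  \<comment> \<open>Exponent \<open>1\<close> is the witness at index zero, where \<open>A2\<close>
    itself is zero.\<close>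
  have "A2 ^\<^sub>m 1 = A2" using A2 by simp
  then have "\<exists>k. A2 ^\<^sub>m k = 0\<^sub>m n n"
    using assms unfolding core_EP_decomposition_def by (metis (full_types))
  then show ?thesis using nilpotent_mat_iff[OF A2] by simp
qed

text \<open>A general \<open>G\<close> lets this serve both matrices: \<open>G\<close> is zero for
  \<open>A\<close> and contains \<open>T3\<close> and \<open>S2\<close> for \<open>B\<close>.
  Extended by zeros, \<open>Q\<close> becomes the left factor that annihilates the core part and
  fixes the nilpotent part.\<close>

lemma core_EP_decomposition_block:
  assumes U: "U \<in> carrier_mat (r + t) (r + t)" "unitary_mat U"
    and T: "T \<in> carrier_mat r r" "invertible_mat T" and S: "S \<in> carrier_mat r t"
    and G: "G \<in> core_invertible t" and K: "K \<in> carrier_mat t t" "nilpotent_mat K"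
    and Q: "Q \<in> carrier_mat t t" "Q * G = 0\<^sub>m t t" "Q * K = K"
    and orth: "mat_adjoint G * K = 0\<^sub>m t t" "K * G = 0\<^sub>m t t"
  shows "core_EP_decomposition (r + t) (ucong U (four_block_mat T S (0\<^sub>m t r) (G + K)))
    (ucong U (four_block_mat T S (0\<^sub>m t r) G)) (ucong U (four_block_mat (0\<^sub>m r r) (0\<^sub>m r t) (0\<^sub>m t r) K))"
proof -
  let ?n = "r + t"
  have Gc: "G \<in> carrier_mat t t" using G unfolding core_invertible_def by simp
  note [simp] = carrier_matD[OF T(1)] carrier_matD[OF S] carrier_matD[OF Gc] carrier_matD[OF K(1)] carrier_matD[OF Q(1)]
  let ?F = "four_block_mat T S (0\<^sub>m t r) G" and ?D = "four_block_mat (0\<^sub>m r r) (0\<^sub>m r t) (0\<^sub>m t r) K"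
    and ?P = "four_block_mat (0\<^sub>m r r) (0\<^sub>m r t) (0\<^sub>m t r) Q"
  have F: "?F \<in> carrier_mat ?n ?n" and D: "?D \<in> carrier_mat ?n ?n" and P: "?P \<in> carrier_mat ?n ?n"
    by (auto intro!: carrier_matI)
  have F': "mat_adjoint ?F \<in> carrier_mat ?n ?n" using F by simp
  have PF: "?P * ?F = 0\<^sub>m ?n ?n" and PD: "?P * ?D = ?D" and DF: "?D * ?F = 0\<^sub>m ?n ?n"
    and FD: "mat_adjoint ?F * ?D = 0\<^sub>m ?n ?n"
    using Q orth by (simp_all add: four_block_mult mat_adjoint_four_block)
  have sum: "ucong U (four_block_mat T S (0\<^sub>m t r) (G + K)) = ucong U ?F + ucong U ?D"
    unfolding ucong_plus[OF U(1) F D] by (simp add: four_block_plus)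
  show ?thesis unfolding sum
  proof (rule core_EP_decompositionI)
    show "ucong U ?F \<in> core_invertible ?n"
      using core_invertible_ucong[OF U F] core_invertible_upper_block[OF T S Gc] G by simp
    show "nilpotent_mat (ucong U ?D)"
      using nilpotent_mat_ucong[OF U D] nilpotent_mat_corner[OF K(1)] K(2) by simp
    show "ucong U ?P * ucong U ?F = 0\<^sub>m ?n ?n" "ucong U ?P * ucong U ?D = ucong U ?D"
      "ucong U ?D * ucong U ?F = 0\<^sub>m ?n ?n"
      unfolding ucong_mult[OF U P F] ucong_mult[OF U P D] ucong_mult[OF U D F] PF PD DF
      by (simp_all add: ucong_zero[OF U(1)])
    show "mat_adjoint (ucong U ?F) * ucong U ?D = 0\<^sub>m ?n ?n"
      unfolding ucong_adjoint[OF U(1) F] ucong_mult[OF U F' D] FD by (rule ucong_zero[OF U(1)])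
  qed (rule ucong_carrier[OF U(1)])+
qed

text \<open>Cancelling \<open>T\<close> in the right relation clears the first block column of
  \<open>D\<close>; cancelling its adjoint in the left relation clears the remaining upper block.
  What is left of the relations concerns \<open>d\<close> and \<open>G\<close>, so the argument can
  be repeated inside the corner.\<close>

lemma annihilator_upper_block:
  fixes T :: "complex mat"
  assumes T: "T \<in> carrier_mat r r" "invertible_mat T" and S: "S \<in> carrier_mat r t" and G: "G \<in> carrier_mat t t"
    and D: "D \<in> carrier_mat (r + t) (r + t)"
    and right: "D * four_block_mat T S (0\<^sub>m t r) G = 0\<^sub>m (r + t) (r + t)"
    and left: "mat_adjoint (four_block_mat T S (0\<^sub>m t r) G) * D = 0\<^sub>m (r + t) (r + t)"
  obtains d where "d \<in> carrier_mat t t" "D = four_block_mat (0\<^sub>m r r) (0\<^sub>m r t) (0\<^sub>m t r) d"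
    "d * G = 0\<^sub>m t t" "mat_adjoint G * d = 0\<^sub>m t t"
proof -
  obtain a b c d where bl: "a \<in> carrier_mat r r" "b \<in> carrier_mat r t" "c \<in> carrier_mat t r" "d \<in> carrier_mat t t"
    and D_eq: "D = four_block_mat a b c d" using four_block_cases[OF D] by metis
  obtain Ti where Ti: "Ti \<in> carrier_mat r r" "T * Ti = 1\<^sub>m r"
    using invertible_matE[OF T(2,1)] by metis
  note [simp] = bl[THEN carrier_matD(1)] bl[THEN carrier_matD(2)] carrier_matD[OF T(1)] carrier_matD[OF S]
    carrier_matD[OF G] carrier_matD[OF Ti(1)]
  have zero: "0\<^sub>m (r + t) (r + t) = four_block_mat (0\<^sub>m r r) (0\<^sub>m r t) (0\<^sub>m t r) (0\<^sub>m t t :: complex mat)"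
    by simp
  have "four_block_mat (a * T) (a * S + b * G) (c * T) (c * S + d * G)
    = 0\<^sub>m (r + t) (r + t)"
    using right unfolding D_eq by (simp add: four_block_mult)
  from trans[OF this zero] have r: "a * T = 0\<^sub>m r r" "c * T = 0\<^sub>m t r" "c * S + d * G = 0\<^sub>m t t"
    by (subst (asm) four_block_eq_iff, auto)+
  have "a = (a * T) * Ti" "c = (c * T) * Ti" using Ti(2) by (simp_all add: mat_mult_assoc)
  then have a: "a = 0\<^sub>m r r" and c: "c = 0\<^sub>m t r" unfolding r by simp_all
  have "four_block_mat (0\<^sub>m r r) (mat_adjoint T * b) (0\<^sub>m t r) (mat_adjoint S * b + mat_adjoint G * d)
    = 0\<^sub>m (r + t) (r + t)"
    using left unfolding D_eq a c by (simp add: four_block_mult mat_adjoint_four_block)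
  from trans[OF this zero] have l: "mat_adjoint T * b = 0\<^sub>m r t" "mat_adjoint S * b + mat_adjoint G * d = 0\<^sub>m t t"
    by (subst (asm) four_block_eq_iff, auto)+
  have "mat_adjoint Ti * mat_adjoint T = 1\<^sub>m r" using mat_adjoint_mult[of T Ti] Ti(2) by simp
  then have "b = mat_adjoint Ti * (mat_adjoint T * b)" by (simp add: mat_mult_assoc[symmetric])
  then have b: "b = 0\<^sub>m r t" unfolding l by simp
  show thesis using that[OF bl(4)] r(3) l(2) unfolding D_eq a b c by simp
qed

text \<open>\<open>D = ?C * Y\<close> has a zero upper block row and \<open>D = W * ?C\<close> a
  zero left block column.\<close>

lemma minus_le_corner_imp_corner:
  assumes D: "D \<in> carrier_mat (r + t) (r + t)" and N: "N \<in> carrier_mat t t"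
    and le: "minus_le D (four_block_mat (0\<^sub>m r r) (0\<^sub>m r t) (0\<^sub>m t r) N)"
  obtains d where "d \<in> carrier_mat t t" "D = four_block_mat (0\<^sub>m r r) (0\<^sub>m r t) (0\<^sub>m t r) d"
proof -
  let ?C = "four_block_mat (0\<^sub>m r r) (0\<^sub>m r t) (0\<^sub>m t r) N"
  note [simp] = carrier_matD[OF N]
  have C: "?C \<in> carrier_mat (r + t) (r + t)" by (intro carrier_matI) auto
  obtain Y where Y: "Y \<in> carrier_mat (r + t) (r + t)" "D = ?C * Y"
    using minus_le_imp_right_factor[OF D C le] by metis
  obtain W where W: "W \<in> carrier_mat (r + t) (r + t)" "D = W * ?C"
    using minus_le_imp_left_factor[OF D C le] by metis
  obtain y1 y2 y3 y4 where y: "y1 \<in> carrier_mat r r" "y2 \<in> carrier_mat r t" "y3 \<in> carrier_mat t r" "y4 \<in> carrier_mat t t"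
    and Y_eq: "Y = four_block_mat y1 y2 y3 y4" using four_block_cases[OF Y(1)] by metis
  obtain w1 w2 w3 w4 where w: "w1 \<in> carrier_mat r r" "w2 \<in> carrier_mat r t" "w3 \<in> carrier_mat t r" "w4 \<in> carrier_mat t t"
    and W_eq: "W = four_block_mat w1 w2 w3 w4" using four_block_cases[OF W(1)] by metis
  note [simp] = y[THEN carrier_matD(1)] y[THEN carrier_matD(2)] w[THEN carrier_matD(1)] w[THEN carrier_matD(2)]
  have D1: "D = four_block_mat (0\<^sub>m r r) (0\<^sub>m r t) (N * y3) (N * y4)"
    unfolding Y(2) Y_eq by (simp add: four_block_mult)
  have "D = four_block_mat (0\<^sub>m r r) (w2 * N) (0\<^sub>m t r) (w4 * N)"
    unfolding W(2) W_eq by (simp add: four_block_mult)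
  then have "four_block_mat (0\<^sub>m r r) (0\<^sub>m r t) (N * y3) (N * y4)
    = four_block_mat (0\<^sub>m r r) (w2 * N) (0\<^sub>m t r) (w4 * N)" unfolding D1 .
  then have "N * y3 = 0\<^sub>m t r" by (subst (asm) four_block_eq_iff) auto
  then show thesis using that[of "N * y4"] D1 N y(4) by simp
qed

section \<open>Nine-block matrices and the two implications\<close>

lemma nine_block_upper:
  "nine_block_mat A (B :: 'a :: zero mat) C (0\<^sub>m s r) E F (0\<^sub>m t r) H I
    = four_block_mat A (append_cols B C) (0\<^sub>m (s + t) r) (four_block_mat E F H I)"
proof -
  have "0\<^sub>m s r @\<^sub>r 0\<^sub>m t r = (0\<^sub>m (s + t) r :: 'a mat)"
    unfolding append_rows_def by (intro eq_matI) auto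
  then show ?thesis unfolding nine_block_mat_def by simp
qed

lemma append_cols_carrier:
  "B \<in> carrier_mat r s \<Longrightarrow> C \<in> carrier_mat r t \<Longrightarrow> append_cols B C \<in> carrier_mat r (s + t)"
  unfolding append_cols_def by (intro carrier_matI) auto

lemma append_cols_cases:
  assumes "M \<in> carrier_mat r (s + t)"
  obtains B C where "B \<in> carrier_mat r s" "C \<in> carrier_mat r t" "M = append_cols B C"
proof -
  have "M \<in> carrier_mat (r + 0) (s + t)" using assms by simp
  from four_block_cases[OF this] obtain B C R S where bl: "B \<in> carrier_mat r s" "C \<in> carrier_mat r t"
    "R \<in> carrier_mat 0 s" "S \<in> carrier_mat 0 t" and M: "M = four_block_mat B C R S" by metis
  have "R = 0\<^sub>m 0 s" "S = 0\<^sub>m 0 t" using bl by (auto intro!: eq_matI)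
  then have "M = append_cols B C" unfolding M append_cols_def using bl by simp
  with bl that show thesis by blast
qed

lemma core_invertible_zero: "0\<^sub>m t t \<in> core_invertible t"
  unfolding core_invertible_def by simp

lemma core_minus_le_imp_block:
  assumes "core_minus_le n A B"
  obtains r s t U T1 M T3 S2 N1 N2 where "n = r + (s + t)" "U \<in> carrier_mat n n" "unitary_mat U"
    "T1 \<in> carrier_mat r r" "invertible_mat T1" "M \<in> carrier_mat r (s + t)"
    "T3 \<in> carrier_mat s s" "invertible_mat T3" "S2 \<in> carrier_mat s t"
    "N1 \<in> carrier_mat t t" "N2 \<in> carrier_mat t t"
    "nilpotent_mat N1" "nilpotent_mat N2" "minus_le N1 N2"
    "A = ucong U (four_block_mat T1 M (0\<^sub>m (s + t) r)
      (four_block_mat (0\<^sub>m s s) (0\<^sub>m s t) (0\<^sub>m t s) N1))"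
    "B = ucong U (four_block_mat T1 M (0\<^sub>m (s + t) r) (four_block_mat T3 S2 (0\<^sub>m t s) N2))"
proof -
  obtain A1 A2 B1 B2 where dA: "core_EP_decomposition n A A1 A2" and dB: "core_EP_decomposition n B B1 B2"
    and le1: "core_le n A1 B1" and le2: "minus_le A2 B2"
    using assms unfolding core_minus_le_def by blast
  have A1: "A1 \<in> core_invertible n" and A2: "A2 \<in> carrier_mat n n" and A: "A = A1 + A2"
    and oA: "mat_adjoint A1 * A2 = 0\<^sub>m n n" "A2 * A1 = 0\<^sub>m n n"
    using dA unfolding core_EP_decomposition_def by auto
  have B1: "B1 \<in> core_invertible n" and B2: "B2 \<in> carrier_mat n n" and B: "B = B1 + B2"
    and oB: "mat_adjoint B1 * B2 = 0\<^sub>m n n" "B2 * B1 = 0\<^sub>m n n"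
    using dB unfolding core_EP_decomposition_def by auto
  have B1c: "B1 \<in> carrier_mat n n" using B1 unfolding core_invertible_def by simp
  obtain r m U0 T1 M0 where n: "n = r + m" and U0: "U0 \<in> carrier_mat n n" "unitary_mat U0"
    and T1: "T1 \<in> carrier_mat r r" "invertible_mat T1" and M0: "M0 \<in> carrier_mat r m"
    and A1_eq: "A1 = ucong U0 (four_block_mat T1 M0 (0\<^sub>m m r) (0\<^sub>m m m))"
    using core_invertible_block_form[OF A1] by blast
  obtain E where E: "E \<in> carrier_mat n n" "B1 = ucong U0 E" using ucong_surj[OF U0 B1c] by metis
  obtain E1 E2 E3 G0 where bl: "E1 \<in> carrier_mat r r" "E2 \<in> carrier_mat r m" "E3 \<in> carrier_mat m r" "G0 \<in> carrier_mat m m"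
    and E_eq: "E = four_block_mat E1 E2 E3 G0" using four_block_cases[OF E(1)[unfolded n]] by metis
  have "E1 = T1 \<and> E2 = M0 \<and> E3 = 0\<^sub>m m r"
    using core_le_block_iff[OF U0[unfolded n] T1 M0 bl] A1 B1 le1
    unfolding A1_eq E(2) E_eq n by simp
  then have B1_eq: "B1 = ucong U0 (four_block_mat T1 M0 (0\<^sub>m m r) G0)" unfolding E(2) E_eq by simp
  note G0 = bl(4)
  have "four_block_mat T1 M0 (0\<^sub>m m r) G0 \<in> carrier_mat n n" unfolding n using T1(1) G0 by simp
  then have "four_block_mat T1 M0 (0\<^sub>m m r) G0 \<in> core_invertible (r + m)"
    using B1 core_invertible_ucong[OF U0] unfolding B1_eq n by simp
  then have "G0 \<in> core_invertible m" using core_invertible_upper_block[OF T1 M0 G0] by simp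
  then obtain s t V T3 S2 where m: "m = s + t" and V: "V \<in> carrier_mat m m" "unitary_mat V"
    and T3: "T3 \<in> carrier_mat s s" "invertible_mat T3" and S2: "S2 \<in> carrier_mat s t"
    and G0_eq: "G0 = ucong V (four_block_mat T3 S2 (0\<^sub>m t s) (0\<^sub>m t t))"
    using core_invertible_block_form by blast
  let ?G = "four_block_mat T3 S2 (0\<^sub>m t s) (0\<^sub>m t t)"
  have G: "?G \<in> carrier_mat m m" unfolding m using T3 by simp
  \<comment> \<open>The refinement fixes the first \<open>r\<close> coordinates, so
    \<open>T1\<close> and the zeros below it survive.\<close>
  define W where "W = four_block_mat (1\<^sub>m r) (0\<^sub>m r m) (0\<^sub>m m r) V"
  have W: "W \<in> carrier_mat n n" "unitary_mat W"
    using unitary_mat_diag[OF one_carrier_mat unitary_mat_one V] unfolding W_def n by auto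
  define U where "U = U0 * W"
  have U: "U \<in> carrier_mat n n" "unitary_mat U"
    using U0 W unitary_mat_mult[OF U0 W] unfolding U_def by auto
  \<comment> \<open>Chosen so that conjugation with \<open>W\<close> turns \<open>M\<close> into
    \<open>M * mat_adjoint V = M0\<close>.\<close>
  define M where "M = M0 * V"
  have M: "M \<in> carrier_mat r m" unfolding M_def using M0 V by simp
  note [simp] = carrier_matD[OF T1(1)] carrier_matD[OF M0] carrier_matD[OF V(1)] carrier_matD[OF M]
  have MV: "M * mat_adjoint V = M0"
    unfolding M_def using unitary_matD[OF V(2,1)] by (simp add: mat_mult_assoc)
  have W_block: "ucong W (four_block_mat T1 M (0\<^sub>m m r) X) = four_block_mat T1 M0 (0\<^sub>m m r) (ucong V X)"
    if X: "X \<in> carrier_mat m m" for X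
    unfolding W_def ucong_diag[OF one_carrier_mat V(1) T1(1) M zero_carrier_mat X]
    using MV by (simp add: ucong_def)
  let ?FA = "four_block_mat T1 M (0\<^sub>m m r) (0\<^sub>m m m)" and ?FB = "four_block_mat T1 M (0\<^sub>m m r) ?G"
  have F: "?FA \<in> carrier_mat n n" "?FB \<in> carrier_mat n n" unfolding n using T1(1) G by simp_all
  have FA: "A1 = ucong U ?FA" unfolding U_def ucong_ucong[OF U0(1) W(1) F(1), symmetric] A1_eq
      W_block[OF zero_carrier_mat] ucong_zero[OF V(1)] ..
  have FB: "B1 = ucong U ?FB" unfolding U_def ucong_ucong[OF U0(1) W(1) F(2), symmetric] B1_eq
      W_block[OF G] G0_eq ..
  obtain DA where DA: "DA \<in> carrier_mat n n" "A2 = ucong U DA" using ucong_surj[OF U A2] by metis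
  obtain DB where DB: "DB \<in> carrier_mat n n" "B2 = ucong U DB" using ucong_surj[OF U B2] by metis
  \<comment> \<open>Vanishing products do not depend on the orthonormal basis; this moves the
    orthogonality relations into the coordinates of \<open>U\<close>.\<close>
  have annihilate: "D * F = 0\<^sub>m n n" "mat_adjoint F * D = 0\<^sub>m n n"
    if "D \<in> carrier_mat n n" "F \<in> carrier_mat n n" "ucong U D * ucong U F = 0\<^sub>m n n"
      "mat_adjoint (ucong U F) * ucong U D = 0\<^sub>m n n" for D F
    using that ucong_eq_zero_iff[OF U, of "D * F"] ucong_eq_zero_iff[OF U, of "mat_adjoint F * D"]
    by (simp_all add: ucong_adjoint[OF U(1)] ucong_mult[OF U] mult_carrier_mat[of _ n n _ n])
  obtain d where d: "d \<in> carrier_mat m m" and DA_eq: "DA = four_block_mat (0\<^sub>m r r) (0\<^sub>m r m) (0\<^sub>m m r) d"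
    using annihilator_upper_block[OF T1 M zero_carrier_mat DA(1)[unfolded n]]
      annihilate[OF DA(1) F(1)] oA unfolding FA DA(2) n by metis
  obtain e where e: "e \<in> carrier_mat m m" and DB_eq: "DB = four_block_mat (0\<^sub>m r r) (0\<^sub>m r m) (0\<^sub>m m r) e"
    and eG: "e * ?G = 0\<^sub>m m m" "mat_adjoint ?G * e = 0\<^sub>m m m"
    using annihilator_upper_block[OF T1 M G DB(1)[unfolded n]]
      annihilate[OF DB(1) F(2)] oB unfolding FB DB(2) n by metis
  \<comment> \<open>The same cancellation one level down, now with \<open>T3\<close> in place of
    \<open>T1\<close>.\<close>
  obtain N2 where N2: "N2 \<in> carrier_mat t t" and e_eq: "e = four_block_mat (0\<^sub>m s s) (0\<^sub>m s t) (0\<^sub>m t s) N2"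
    using annihilator_upper_block[OF T3 S2 zero_carrier_mat e[unfolded m]] eG unfolding m by metis
  have "minus_le d e"
    using le2 minus_le_ucong[OF U DA(1) DB(1)] minus_le_corner[OF d e]
    unfolding DA(2) DB(2) DA_eq DB_eq by simp
  \<comment> \<open>The orthogonality relations put no constraint on \<open>d\<close>; its zeros
    come from the minus order.\<close>
  then obtain N1 where N1: "N1 \<in> carrier_mat t t" and d_eq: "d = four_block_mat (0\<^sub>m s s) (0\<^sub>m s t) (0\<^sub>m t s) N1"
    using minus_le_corner_imp_corner[OF d[unfolded m] N2] unfolding e_eq by metis
  have le: "minus_le N1 N2" using \<open>minus_le d e\<close> minus_le_corner[OF N1 N2] unfolding d_eq e_eq by simp
  have "nilpotent_mat N1"
    using core_EP_decomposition_nilpotent[OF dA] nilpotent_mat_ucong[OF U DA(1)] nilpotent_mat_corner[OF d]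
      nilpotent_mat_corner[OF N1] unfolding DA(2) DA_eq d_eq by simp
  moreover have "nilpotent_mat N2"
    using core_EP_decomposition_nilpotent[OF dB] nilpotent_mat_ucong[OF U DB(1)] nilpotent_mat_corner[OF e]
      nilpotent_mat_corner[OF N2] unfolding DB(2) DB_eq e_eq by simp
  moreover have "A = ucong U (four_block_mat T1 M (0\<^sub>m m r) d)"
    using carrier_matD[OF d] unfolding A FA DA(2) ucong_plus[OF U(1) F(1) DA(1)] unfolding DA_eq
    by (simp add: four_block_plus)
  moreover have "B = ucong U (four_block_mat T1 M (0\<^sub>m m r) (four_block_mat T3 S2 (0\<^sub>m t s) N2))"
  proof -
    have "?G + e = four_block_mat T3 S2 (0\<^sub>m t s) N2"
      using carrier_matD[OF T3(1)] carrier_matD[OF S2] carrier_matD[OF N2] unfolding e_eq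
      by (simp add: four_block_plus)
    moreover have "B = ucong U (four_block_mat T1 M (0\<^sub>m m r) (?G + e))"
      using carrier_matD[OF e] carrier_matD[OF G] unfolding B FB DB(2) ucong_plus[OF U(1) F(2) DB(1)] unfolding DB_eq
      by (simp add: four_block_plus)
    ultimately show ?thesis by simp
  qed
  ultimately show thesis
    using that[of r s t U T1 M T3 S2 N1 N2] n U T1 M T3 S2 N1 N2 le unfolding m d_eq by blast
qed

text \<open>Both core-EP decompositions can be displayed in the basis \<open>U\<close>: the core
  parts share their first block row and column, and the nilpotent parts are corners.\<close>

lemma core_minus_leI_block:
  assumes n: "n = r + (s + t)" and U: "U \<in> carrier_mat n n" "unitary_mat U"
    and T1: "T1 \<in> carrier_mat r r" "invertible_mat T1" and M: "M \<in> carrier_mat r (s + t)"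
    and T3: "T3 \<in> carrier_mat s s" "invertible_mat T3" and S2: "S2 \<in> carrier_mat s t"
    and N1: "N1 \<in> carrier_mat t t" "nilpotent_mat N1" and N2: "N2 \<in> carrier_mat t t" "nilpotent_mat N2"
    and le: "minus_le N1 N2"
  shows "core_minus_le n
    (ucong U (four_block_mat T1 M (0\<^sub>m (s + t) r) (four_block_mat (0\<^sub>m s s) (0\<^sub>m s t) (0\<^sub>m t s) N1)))
    (ucong U (four_block_mat T1 M (0\<^sub>m (s + t) r) (four_block_mat T3 S2 (0\<^sub>m t s) N2)))"
proof -
  let ?m = "s + t"
  let ?C = "\<lambda>N. four_block_mat (0\<^sub>m s s) (0\<^sub>m s t) (0\<^sub>m t s) N"
  let ?D = "\<lambda>X. four_block_mat (0\<^sub>m r r) (0\<^sub>m r ?m) (0\<^sub>m ?m r) X"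
  let ?G = "four_block_mat T3 S2 (0\<^sub>m t s) (0\<^sub>m t t)"
  let ?FA = "four_block_mat T1 M (0\<^sub>m ?m r) (0\<^sub>m ?m ?m)" and ?FB = "four_block_mat T1 M (0\<^sub>m ?m r) ?G"
  note U' = U[unfolded n]
  note [simp] = carrier_matD[OF T1(1)] carrier_matD[OF M] carrier_matD[OF T3(1)] carrier_matD[OF S2]
    carrier_matD[OF N1(1)] carrier_matD[OF N2(1)]
  have C: "?C N1 \<in> carrier_mat ?m ?m" "?C N2 \<in> carrier_mat ?m ?m" "?C (1\<^sub>m t) \<in> carrier_mat ?m ?m"
    and G: "?G \<in> carrier_mat ?m ?m" by (auto intro!: carrier_matI)
  have D: "?D (?C N1) \<in> carrier_mat n n" "?D (?C N2) \<in> carrier_mat n n"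
    and F: "?FA \<in> carrier_mat n n" "?FB \<in> carrier_mat n n"
    unfolding n by (auto intro!: carrier_matI)
  have nil: "nilpotent_mat (?C N1)" "nilpotent_mat (?C N2)"
    using nilpotent_mat_corner[OF N1(1)] nilpotent_mat_corner[OF N2(1)] N1 N2 by auto
  have Gci: "?G \<in> core_invertible ?m"
    using core_invertible_upper_block[OF T3 S2 zero_carrier_mat] core_invertible_zero by simp
  \<comment> \<open>Here \<open>G\<close> is zero, so the identity can be taken for
    \<open>Q\<close>.\<close>
  have "core_EP_decomposition (r + ?m) (ucong U (four_block_mat T1 M (0\<^sub>m ?m r) (0\<^sub>m ?m ?m + ?C N1)))
      (ucong U ?FA) (ucong U (?D (?C N1)))"
    by (rule core_EP_decomposition_block[OF U' T1 M core_invertible_zero C(1) nil(1) one_carrier_mat]) simp_all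
  then have dA: "core_EP_decomposition n (ucong U (four_block_mat T1 M (0\<^sub>m ?m r) (?C N1)))
      (ucong U ?FA) (ucong U (?D (?C N1)))" unfolding n by simp
  \<comment> \<open>As \<open>Q\<close> serves the projector \<open>?C (1\<^sub>m t)\<close> onto
    the last \<open>t\<close> coordinates: it annihilates \<open>?G\<close>, whose lower block row
    is zero, and fixes \<open>?C N2\<close>.\<close>
  have "core_EP_decomposition (r + ?m) (ucong U (four_block_mat T1 M (0\<^sub>m ?m r) (?G + ?C N2)))
      (ucong U ?FB) (ucong U (?D (?C N2)))"
    by (rule core_EP_decomposition_block[OF U' T1 M Gci C(2) nil(2) C(3)])
      (simp_all add: four_block_mult mat_adjoint_four_block)
  then have dB: "core_EP_decomposition n (ucong U (four_block_mat T1 M (0\<^sub>m ?m r) (four_block_mat T3 S2 (0\<^sub>m t s) N2)))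
      (ucong U ?FB) (ucong U (?D (?C N2)))" unfolding n by (simp add: four_block_plus)
  have ci: "ucong U ?FA \<in> core_invertible (r + ?m)" "ucong U ?FB \<in> core_invertible (r + ?m)"
    using dA dB unfolding core_EP_decomposition_def n by auto
  have "core_le n (ucong U ?FA) (ucong U ?FB)"
    using core_le_block_iff[OF U' T1 M T1(1) M zero_carrier_mat G ci] unfolding n by simp
  moreover have "minus_le (ucong U (?D (?C N1))) (ucong U (?D (?C N2)))"
    using minus_le_ucong[OF U D] minus_le_corner[OF C(1,2)] minus_le_corner[OF N1(1) N2(1)] le by simp
  ultimately show ?thesis unfolding core_minus_le_def using dA dB by blast
qed

theorem theorem5p3:
  fixes A B :: "complex mat" and n :: nat
  assumes "A \<in> carrier_mat n n" and "B \<in> carrier_mat n n"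
  shows "core_minus_le n A B \<longleftrightarrow>
    (\<exists>r s t U T1 T2 T3 S1 S2 N1 N2.
       r + s + t = n \<and>
       U \<in> carrier_mat n n \<and> unitary_mat U \<and>
       T1 \<in> carrier_mat r r \<and> T2 \<in> carrier_mat r s \<and> S1 \<in> carrier_mat r t \<and>
       T3 \<in> carrier_mat s s \<and> S2 \<in> carrier_mat s t \<and>
       N1 \<in> carrier_mat t t \<and> N2 \<in> carrier_mat t t \<and>
       A = U * nine_block_mat
                 T1         T2         S1
                 (0\<^sub>m s r) (0\<^sub>m s s) (0\<^sub>m s t)
                 (0\<^sub>m t r) (0\<^sub>m t s) N1 * mat_adjoint U \<and>
       B = U * nine_block_mat
                 T1         T2         S1
                 (0\<^sub>m s r) T3         S2
                 (0\<^sub>m t r) (0\<^sub>m t s) N2 * mat_adjoint U \<and>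
       invertible_mat T1 \<and> invertible_mat T3 \<and>
       nilpotent_mat N1 \<and> nilpotent_mat N2 \<and> minus_le N1 N2)" (is "_ \<longleftrightarrow> ?R")
proof
  assume "core_minus_le n A B"
  then obtain r s t U T1 M T3 S2 N1 N2 where n: "n = r + (s + t)"
    and U: "U \<in> carrier_mat n n" "unitary_mat U"
    and T1: "T1 \<in> carrier_mat r r" "invertible_mat T1" and M: "M \<in> carrier_mat r (s + t)"
    and T3: "T3 \<in> carrier_mat s s" "invertible_mat T3" and S2: "S2 \<in> carrier_mat s t"
    and N: "N1 \<in> carrier_mat t t" "N2 \<in> carrier_mat t t" "nilpotent_mat N1" "nilpotent_mat N2" "minus_le N1 N2"
    and A: "A = ucong U (four_block_mat T1 M (0\<^sub>m (s + t) r)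
      (four_block_mat (0\<^sub>m s s) (0\<^sub>m s t) (0\<^sub>m t s) N1))"
    and B: "B = ucong U (four_block_mat T1 M (0\<^sub>m (s + t) r) (four_block_mat T3 S2 (0\<^sub>m t s) N2))"
    by (rule core_minus_le_imp_block)
  obtain T2 S1 where "T2 \<in> carrier_mat r s" "S1 \<in> carrier_mat r t" "M = append_cols T2 S1"
    using append_cols_cases[OF M] by metis
  moreover have "r + s + t = n" using n by simp
  ultimately show ?R
    using U T1 T3 S2 N A B unfolding nine_block_upper ucong_def by blast
next
  assume ?R
  then obtain r s t U T1 T2 T3 S1 S2 N1 N2 where n: "r + s + t = n"
    and U: "U \<in> carrier_mat n n" "unitary_mat U"
    and T1: "T1 \<in> carrier_mat r r" "invertible_mat T1"
    and M: "T2 \<in> carrier_mat r s" "S1 \<in> carrier_mat r t"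
    and T3: "T3 \<in> carrier_mat s s" "invertible_mat T3" and S2: "S2 \<in> carrier_mat s t"
    and N: "N1 \<in> carrier_mat t t" "N2 \<in> carrier_mat t t" "nilpotent_mat N1" "nilpotent_mat N2" "minus_le N1 N2"
    and A: "A = ucong U (four_block_mat T1 (append_cols T2 S1) (0\<^sub>m (s + t) r)
      (four_block_mat (0\<^sub>m s s) (0\<^sub>m s t) (0\<^sub>m t s) N1))"
    and B: "B = ucong U (four_block_mat T1 (append_cols T2 S1) (0\<^sub>m (s + t) r)
      (four_block_mat T3 S2 (0\<^sub>m t s) N2))"
    unfolding nine_block_upper ucong_def by blast
  have "n = r + (s + t)" using n by simp
  from core_minus_leI_block[OF this U T1 append_cols_carrier[OF M] T3 S2 N(1,3,2,4,5)]
  show "core_minus_le n A B" unfolding A B .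
qed

end
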